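(* Let $q=p^m$ where $p$ is a prime with $p>5$ and $m\ge 1$, and suppose $q\equiv 1 \pmod 6$ and $q\notin\{7,19,313\}$. Let $f(x)=x^{q+2}$ on $\mathbb{F}_{q^2}$. Then the boomerang uniformity of $f$ is $\beta_f=5$.
   Context: For a function $f:\mathbb{F}_{Q}\to\mathbb{F}_{Q}$ and $a,b\in\mathbb{F}_{Q}$, $\beta_f(a,b)$ denotes the number of pairs $(x,y)\in\mathbb{F}_{Q}^2$ satisfying $f(x)-f(y)=b$ and $f(x+a)-f(y+a)=b$. The boomerang uniformity is $\beta_f=\max_{a,b\in\mathbb{F}_Q^*}\beta_f(a,b)$. *)

theory Defs
  imports Main "HOL-Computational_Algebra.Primes"
begin

definition boomerang_count :: "('a::field \<Rightarrow> 'a) \<Rightarrow> 'a \<Rightarrow> 'a \<Rightarrow> nat" where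
  "boomerang_count f a b =
     card {(x, y). f x - f y = b \<and> f (x + a) - f (y + a) = b}"

definition boomerang_uniformity :: "('a::{field,finite} \<Rightarrow> 'a) \<Rightarrow> nat" where
  "boomerang_uniformity f =
     Max {boomerang_count f a b | a b. a \<noteq> 0 \<and> b \<noteq> 0}"

end

theory Submission
  imports Defs "HOL-Computational_Algebra.Polynomial" "HOL-Library.FuncSet"
begin

text \<open>
  Write \<open>x\<^sup>q\<close> as the conjugate of \<open>x\<close> over the subfield \<open>K\<close> with \<open>q\<close> elements, so that \<open>f(x) = x\<^sup>2 cj(x)\<close>.
  By homogeneity \<open>a = 1\<close>. In terms of \<open>z = 2 x + 1\<close> and \<open>w = 2 y + 1\<close> the two boomerang equations make the
  quadratic form \<open>z\<^sup>2 + 2 z cj(z)\<close> agree at \<open>z\<close> and \<open>w\<close>; since \<open>-3\<close> is a square in \<open>K\<close>, this forces \<open>w = \<plusminus>z\<close>.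
  As \<open>b \<noteq> 0\<close>, only \<open>w = -z\<close> remains, and the count is the size of the fibre over \<open>4 b\<close> of
  \<open>g(t) = t\<^sup>2 cj(t) + 2 t + cj(t)\<close>. Such a fibre is parametrised by the roots of a quintic in the norm of \<open>t\<close>,
  apart from two degenerate cases in which it is covered by a cubic and a quadratic equation.

  A fibre with five points exists over some \<open>c\<close> with \<open>cj(c) = -c\<close>. Splitting the cubic by Cardano's formula, one
  needs some \<open>v\<close> with \<open>cj(v) = -v\<close> such that \<open>v\<^sup>1\<^sup>2 + 322 v\<^sup>6 + 1\<close> is a nonsquare in \<open>K\<close>. For \<open>q \<ge> 639\<close>
  this follows from Stepanov's method, in which a nonzero auxiliary polynomial vanishing to order 18 at all
  would-be exceptions is found by the pigeonhole principle; for smaller \<open>q\<close> explicit solutions are verified.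
\<close>

section \<open>Finite fields\<close>

lemma card_le_fibres:
  assumes "finite A" and "\<And>y. card {x \<in> A. f x = y} \<le> n"
  shows "card A \<le> n * card (f ` A)"
proof -
  have "A = (\<Union>y\<in>f ` A. {x \<in> A. f x = y})"
    by auto
  then have "card A \<le> (\<Sum>y\<in>f ` A. card {x \<in> A. f x = y})"
    using card_UN_le[of "f ` A" "\<lambda>y. {x \<in> A. f x = y}"] \<open>finite A\<close> by simp
  also have "\<dots> \<le> (\<Sum>y\<in>f ` A. n)"
    by (intro sum_mono assms)
  finally show ?thesis
    by (simp add: mult.commute)
qed

lemma card_le_degree:
  fixes P :: "'a::{comm_ring_1,ring_no_zero_divisors} poly"
  assumes "coeff P n \<noteq> 0" "degree P \<le> n" "\<And>x. x \<in> A \<Longrightarrow> poly P x = 0"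
  shows "card A \<le> n"
proof -
  from assms(1) have "P \<noteq> 0"
    by auto
  then have "card A \<le> card {x. poly P x = 0}"
    using assms(3) by (intro card_mono poly_roots_finite) auto
  with card_poly_roots_bound[OF \<open>P \<noteq> 0\<close>] assms(2) show ?thesis
    by linarith
qed

lemma card_nth_roots_le:
  fixes c :: "'a::{comm_ring_1,ring_no_zero_divisors}"
  assumes "n > 0"
  shows "card {x \<in> A. x ^ n = c} \<le> n"
proof (rule card_le_degree[of "monom 1 n - [:c:]"])
  show "coeff (monom 1 n - [:c:]) n \<noteq> 0" "degree (monom 1 n - [:c:]) \<le> n"
    using assms by (auto simp: coeff_pCons split: nat.split intro!: degree_diff_le degree_monom_le)
qed (simp add: poly_monom)

lemma finite_field_power_card:
  fixes x :: "'a::{field,finite}"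
  shows "x ^ card (UNIV :: 'a set) = x"
proof (cases "x = 0")
  case False
  have "(\<Prod>y\<in>UNIV - {0}. x * y) = (\<Prod>y\<in>UNIV - {0}. y)"
    by (rule prod.reindex_bij_witness[of _ "\<lambda>y. y / x" "\<lambda>y. x * y"]) (use False in auto)
  then have "x ^ card (UNIV - {0::'a}) * \<Prod>(UNIV - {0}) = 1 * \<Prod>(UNIV - {0})"
    by (simp add: prod.distrib)
  moreover have nz: "\<Prod>(UNIV - {0::'a}) \<noteq> 0"
    by (simp add: prod_zero_iff)
  ultimately have "x ^ card (UNIV - {0::'a}) = 1"
    by (simp only: mult_right_cancel[OF nz])
  moreover have "card (UNIV :: 'a set) = Suc (card (UNIV - {0::'a}))"
    by (intro card.remove) simp_all
  ultimately show ?thesis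
    by (simp only: power_Suc mult_1_right)
qed (simp add: finite_UNIV_card_ge_0)

text \<open>The \<open>n\<close>-th powers of nonzero elements are \<open>k\<close>-th roots of
  unity. Fibres of size at most \<open>n\<close> give at least \<open>k\<close> such powers, while
  there are at most \<open>k\<close> such roots, so the two sets coincide.\<close>

lemma ex_nth_root:
  fixes x :: "'a::{field,finite}"
  assumes "n * k = card (UNIV :: 'a set) - 1" and "n * k > 0" and "x ^ k = 1"
  shows "\<exists>y. y ^ n = x"
proof -
  let ?S = "(\<lambda>y. y ^ n) ` (UNIV - {0::'a})"
  have sub: "?S \<subseteq> {z \<in> UNIV. z ^ k = 1}"
  proof clarsimp
    fix y :: 'a assume "y \<noteq> 0"
    have "y ^ (card (UNIV :: 'a set) - 1) * y = y"
      by (subst power_minus_mult) (simp_all add: finite_UNIV_card_ge_0 finite_field_power_card)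
    with \<open>y \<noteq> 0\<close> assms(1) show "(y ^ n) ^ k = 1"
      by (simp flip: power_mult)
  qed
  have "card (UNIV :: 'a set) - 1 \<le> n * card ?S"
    using card_le_fibres[of "UNIV - {0::'a}" "\<lambda>y. y ^ n" n] card_nth_roots_le[of n "UNIV - {0::'a}"] assms(2)
    by (simp add: card_Diff_singleton)
  then have "k \<le> card ?S"
    unfolding assms(1)[symmetric] using assms(2) by simp
  then have "?S = {z \<in> UNIV. z ^ k = 1}"
    using card_nth_roots_le[of k UNIV "1::'a"] assms(2) sub
    by (intro card_seteq) auto
  moreover have "x \<in> {z \<in> UNIV. z ^ k = 1}"
    using assms(3) by simp
  ultimately have "x \<in> ?S"
    by simp
  then show ?thesis
    by blast
qed

section \<open>Stepanov's method\<close>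

text \<open>Bounding the support rather than the degree makes \<open>n = 0\<close> give only the
  zero polynomial, so the cardinality formula holds for every \<open>n\<close>.\<close>

definition polys_below :: "nat \<Rightarrow> 'a::zero poly set" where
  "polys_below n = {f. \<forall>i\<ge>n. coeff f i = 0}"

lemma polys_below_iff_degree: "n > 0 \<Longrightarrow> f \<in> polys_below n \<longleftrightarrow> degree f < n"
  by (auto simp: polys_below_def coeff_eq_0 intro!: degree_lessI)

lemma polys_below_Suc: "polys_below (Suc n) = (\<lambda>(c, f). pCons c f) ` (UNIV \<times> polys_below n)"
proof (intro equalityI subsetI)
  fix h :: "'a poly" assume h: "h \<in> polys_below (Suc n)"
  obtain c f where cf: "h = pCons c f"
    by (rule pCons_cases)
  have "f \<in> polys_below n"
    using h by (fastforce simp: polys_below_def cf coeff_pCons)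
  with cf show "h \<in> (\<lambda>(c, f). pCons c f) ` (UNIV \<times> polys_below n)"
    by auto
qed (auto simp: polys_below_def coeff_pCons split: nat.split)

lemma polys_below_finite_card:
  "finite (polys_below n :: 'a::{finite,zero} poly set) \<and> card (polys_below n :: 'a poly set) = card (UNIV :: 'a set) ^ n"
proof (induction n)
  case 0
  have "polys_below 0 = {0 :: 'a poly}"
    by (auto simp: polys_below_def poly_eq_iff)
  then show ?case
    by simp
next
  case (Suc n)
  have "inj_on (\<lambda>(c, f). pCons c f) (UNIV \<times> (polys_below n :: 'a poly set))"
    by (auto simp: inj_on_def)
  with Suc show ?case
    unfolding polys_below_Suc by (simp add: card_image card_cartesian_product)
qed

lemma card_times_le_degree:
  fixes R :: "'a::{idom} poly"
  assumes "R \<noteq> 0" "M > 0" "\<And>v. v \<in> S \<Longrightarrow> [:- v, 1:] ^ M dvd R"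
  shows "card S * M \<le> degree R"
proof -
  have order: "M \<le> order v R" if "v \<in> S" for v
    using assms that order_divides by blast
  have "S \<subseteq> {x. poly R x = 0}"
  proof clarify
    fix v assume "v \<in> S"
    with order[of v] assms(2) have "order v R \<noteq> 0"
      by simp
    then show "poly R v = 0"
      by (simp add: order_root)
  qed
  then have "(\<Sum>v\<in>S. order v R) \<le> (\<Sum>v | poly R v = 0. order v R)"
    using poly_roots_finite[OF assms(1)] by (intro sum_mono2) auto
  moreover have "(\<Sum>v\<in>S. M) \<le> (\<Sum>v\<in>S. order v R)"
    by (intro sum_mono order)
  ultimately show ?thesis
    using sum_order_le_degree[OF assms(1)] by simp
qed

text \<open>
  \<open>expand F f\<close> is \<open>f(X + F Z)\<close> as a polynomial in \<open>Z\<close>. With the step \<open>F Z\<close> in place of \<open>Z\<close>, the expansion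
  of \<open>F\<close> itself is \<open>F U\<close> with \<open>U\<close> a polynomial, so the expansion of a power \<open>F\<^sup>N\<close> costs no degree
  beyond the factor \<open>F\<^sup>N\<close>, however large \<open>N\<close> is. It takes the place of the Hasse derivatives, which
  must replace the ordinary derivatives in positive characteristic.
\<close>

definition expand :: "'a::comm_ring_1 poly \<Rightarrow> 'a poly \<Rightarrow> 'a poly poly" where
  "expand F f = pcompose (map_poly (\<lambda>c. [:c:]) f) [:[:0, 1:], F:]"

lemma expand_0 [simp]: "expand F 0 = 0"
  by (simp add: expand_def)

lemma expand_pCons: "expand F (pCons c f) = [:[:c:]:] + [:[:0, 1:], F:] * expand F f"
  by (simp add: expand_def map_poly_pCons pcompose_pCons)

lemma expand_diff: "expand F (f - h) = expand F f - expand F h"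
proof -
  have "map_poly (\<lambda>c. [:c:]) (f - h) = map_poly (\<lambda>c. [:c:]) f - map_poly (\<lambda>c. [:c:]) h"
    by (intro poly_eqI) (simp add: coeff_map_poly)
  then show ?thesis
    by (simp add: expand_def pcompose_diff)
qed

definition specialize :: "'a::comm_ring_1 \<Rightarrow> 'a poly poly \<Rightarrow> 'a poly" where
  "specialize v P = map_poly (\<lambda>c. poly c v) P"

lemma coeff_specialize [simp]: "coeff (specialize v P) l = poly (coeff P l) v"
  by (simp add: specialize_def coeff_map_poly)

lemma specialize_add [simp]: "specialize v (P + Q) = specialize v P + specialize v Q"
  by (rule poly_eqI) simp

lemma specialize_mult [simp]: "specialize v (P * Q) = specialize v P * specialize v Q"
  by (rule poly_eqI) (simp add: coeff_mult poly_sum)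

lemma specialize_pCons [simp]: "specialize v (pCons c P) = pCons (poly c v) (specialize v P)"
  by (simp add: specialize_def map_poly_pCons)

lemma specialize_smult [simp]: "specialize v (smult c P) = smult (poly c v) (specialize v P)"
  by (rule poly_eqI) simp

lemma specialize_0 [simp]: "specialize v 0 = 0"
  by (simp add: specialize_def)

lemma specialize_1 [simp]: "specialize v 1 = 1"
  by (simp add: one_pCons)

lemma specialize_power [simp]: "specialize v (P ^ n) = specialize v P ^ n"
  by (induction n) simp_all

lemma specialize_expand: "specialize v (expand F f) = pcompose f [:v, poly F v:]"
  by (induction f) (simp_all add: expand_pCons pcompose_pCons)

text \<open>\<open>X + F Z\<close> is congruent to \<open>X\<close> modulo \<open>F\<close>. For
  \<open>f = F\<close> this makes \<open>F\<close> a factor of its own expansion.\<close>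

lemma expand_cong_mod: "\<exists>G. expand F f = [:f:] + [:F:] * G"
proof (induction f)
  case 0
  then show ?case
    by (intro exI[of _ 0]) simp
next
  case (pCons c f)
  then obtain G where G: "expand F f = [:f:] + [:F:] * G"
    by blast
  have "[:[:0, 1:], F:] = [:[:0, 1:]:] + [:F:] * [:0, 1:]"
    by simp
  then have "expand F (pCons c f) = [:[:c:]:] + [:[:0, 1:]:] * expand F f + [:F:] * ([:0, 1:] * expand F f)"
    by (simp only: expand_pCons distrib_right mult.assoc add.assoc)
  also have "[:[:0, 1:]:] * expand F f = [:[:0, 1:] * f:] + [:F:] * ([:[:0, 1:]:] * G)"
    unfolding G by (simp add: smult_add_right mult.commute[of F])
  also have "[:[:c:]:] + ([:[:0, 1:] * f:] + [:F:] * ([:[:0, 1:]:] * G)) + [:F:] * ([:0, 1:] * expand F f)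
      = [:pCons c f:] + [:F:] * ([:[:0, 1:]:] * G + [:0, 1:] * expand F f)"
    by (simp add: distrib_left)
  finally show ?case
    by blast
qed

text \<open>A degree in which \<open>X\<close> counts 1 and \<open>Z\<close> counts
  \<open>-k\<close>. For \<open>degree F = Suc k\<close> the step \<open>F Z\<close> then counts 1
  like \<open>X\<close>, so expanding does not raise the degree.\<close>

definition weight_le :: "nat \<Rightarrow> nat \<Rightarrow> 'a::comm_ring_1 poly poly \<Rightarrow> bool" where
  "weight_le k D P \<longleftrightarrow> (\<forall>l. degree (coeff P l) \<le> D + k * l)"

lemma weight_le_mono: "weight_le k D P \<Longrightarrow> D \<le> D' \<Longrightarrow> weight_le k D' P"
  unfolding weight_le_def by (meson add_le_mono1 le_trans)

lemma weight_le_add: "weight_le k D P \<Longrightarrow> weight_le k D Q \<Longrightarrow> weight_le k D (P + Q)"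
  unfolding weight_le_def by (auto intro: degree_add_le)

lemma weight_le_mult:
  assumes "weight_le k D P" "weight_le k E Q"
  shows "weight_le k (D + E) (P * Q)"
  unfolding weight_le_def
proof
  fix l
  have "degree (coeff P i * coeff Q (l - i)) \<le> D + E + k * l" if "i \<le> l" for i
  proof -
    have "degree (coeff P i * coeff Q (l - i)) \<le> (D + k * i) + (E + k * (l - i))"
      using assms unfolding weight_le_def
      by (intro order_trans[OF degree_mult_le] add_mono) auto
    also have "\<dots> = D + E + k * (i + (l - i))"
      by (simp only: distrib_left add_ac)
    finally show ?thesis
      using that by simp
  qed
  then show "degree (coeff (P * Q) l) \<le> D + E + k * l"
    unfolding coeff_mult by (intro degree_sum_le) auto
qed

lemma weight_le_const: "degree c \<le> D \<Longrightarrow> weight_le k D [:c:]"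
  by (auto simp: weight_le_def coeff_pCons split: nat.split)

lemma weight_le_power: "weight_le k 0 P \<Longrightarrow> weight_le k 0 (P ^ n)"
proof (induction n)
  case 0
  then show ?case
    using weight_le_const[of 1 0 k] by (simp add: one_pCons)
next
  case (Suc n)
  then show ?case
    using weight_le_mult[of k 0 P 0 "P ^ n"] by simp
qed

lemma weight_le_expand:
  assumes "degree F \<le> Suc k"
  shows "weight_le k (degree f) (expand F f)"
proof (induction f)
  case 0
  then show ?case
    by (simp add: weight_le_def)
next
  case (pCons c f)
  have "weight_le k 1 [:[:0, 1:], F:]"
    using assms by (auto simp: weight_le_def coeff_pCons split: nat.split)
  from weight_le_mult[OF this pCons.IH] have "weight_le k (degree (pCons c f)) ([:[:0, 1:], F:] * expand F f)"
    by (cases "f = 0") (simp_all add: weight_le_def)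
  then show ?case
    unfolding expand_pCons by (intro weight_le_add weight_le_const) simp_all
qed

text \<open>Cancelling \<open>F\<close> takes \<open>Suc k\<close> off every coefficient degree and
  leaves a cofactor of weight 0, all of whose powers again have weight 0.\<close>

lemma expand_self:
  fixes F :: "'a::idom poly"
  assumes "degree F = Suc k"
  obtains U where "expand F F = [:F:] * U" "weight_le k 0 U"
proof -
  obtain G where "expand F F = [:F:] + [:F:] * G"
    using expand_cong_mod by blast
  then have U: "expand F F = [:F:] * (1 + G)"
    by (simp add: smult_add_right one_pCons)
  have "degree (coeff (1 + G) l) \<le> k * l" for l
  proof (cases "coeff (1 + G) l = 0")
    case False
    moreover have "F \<noteq> 0"
      using assms by auto
    ultimately have "degree (coeff (expand F F) l) = Suc k + degree (coeff (1 + G) l)"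
      unfolding U by (simp add: degree_mult_eq assms del: coeff_add)
    moreover have "degree (coeff (expand F F) l) \<le> Suc k + k * l"
      using weight_le_expand[of F k F] assms by (simp add: weight_le_def)
    ultimately show ?thesis
      by simp
  qed simp
  with U show ?thesis
    by (intro that[of "1 + G"]) (simp_all add: weight_le_def)
qed

text \<open>
  In Stepanov's auxiliary polynomial \<open>\<Sum>\<^sub>j X\<^sup>q\<^sup>j (a\<^sub>j + b\<^sub>j F\<^sup>N)\<close>, the \<open>l\<close>-th coefficient of the local expansion
  at a point \<open>v\<close> with \<open>v\<^sup>q = e v\<close> and \<open>F(v)\<^sup>N = 1\<close> is the value at \<open>v\<close> of a polynomial of low degree.
\<close>

definition local_coeff ::
    "'a::comm_ring_1 poly \<Rightarrow> 'a poly poly \<Rightarrow> 'a \<Rightarrow> nat \<Rightarrow> (nat \<Rightarrow> 'a poly) \<Rightarrow> (nat \<Rightarrow> 'a poly) \<Rightarrow>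
      nat \<Rightarrow> 'a poly" where
  "local_coeff F V e J a b l = (\<Sum>j<J. monom (e ^ j) j * coeff (expand F (a j) + expand F (b j) * V) l)"

lemma local_coeff_diff:
  "local_coeff F V e J (\<lambda>j. a j - a' j) (\<lambda>j. b j - b' j) l
    = local_coeff F V e J a b l - local_coeff F V e J a' b' l"
  by (simp add: local_coeff_def expand_diff algebra_simps flip: sum_subtractf)

lemma degree_local_coeff:
  assumes "degree F \<le> Suc k" "weight_le k 0 V" "J > 0"
    and "\<And>j. j < J \<Longrightarrow> degree (a j) \<le> D \<and> degree (b j) \<le> D"
  shows "degree (local_coeff F V e J a b l) < J + D + k * l"
proof -
  have "degree (monom (e ^ j) j * coeff (expand F (a j) + expand F (b j) * V) l) \<le> (J - 1) + (D + k * l)"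
    if j: "j < J" for j
  proof -
    have w: "weight_le k D (expand F f)" if "degree f \<le> D" for f
      using weight_le_mono[OF weight_le_expand[OF assms(1)] that] .
    have "weight_le k D (expand F (a j) + expand F (b j) * V)"
      using assms(4)[OF j] weight_le_mult[OF w assms(2)] by (intro weight_le_add w) simp_all
    then have "degree (coeff (expand F (a j) + expand F (b j) * V) l) \<le> D + k * l"
      by (simp add: weight_le_def)
    moreover have "degree (monom (e ^ j) j) \<le> J - 1"
      using j by (intro order_trans[OF degree_monom_le]) simp
    ultimately show ?thesis
      by (intro order_trans[OF degree_mult_le] add_mono)
  qed
  then have "degree (local_coeff F V e J a b l) \<le> (J - 1) + (D + k * l)"
    unfolding local_coeff_def by (intro degree_sum_le) auto
  then show ?thesis
    using assms(3) by simp
qed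

text \<open>A finite form of Siegel's lemma: \<open>2 * J * Suc D\<close> free coefficients give
  more tuples than there are values of the \<open>M\<close> local coefficients. Two tuples collide,
  and their difference is the solution.\<close>

lemma ex_local_coeffs_zero:
  fixes F :: "'a::{field,finite} poly"
  assumes F: "degree F \<le> Suc k" and V: "weight_le k 0 V" and J: "J > 0"
    and count: "(\<Sum>l<M. J + D + k * l) < 2 * J * Suc D"
  obtains a b where "\<And>j. degree (a j) \<le> D" "\<And>j. degree (b j) \<le> D" "\<exists>j<J. a j \<noteq> 0 \<or> b j \<noteq> 0"
    "\<And>l. l < M \<Longrightarrow> local_coeff F V e J a b l = 0"
proof -
  let ?Q = "card (UNIV :: 'a set)"
  let ?X = "{..<2 * J} \<rightarrow>\<^sub>E (polys_below (Suc D) :: 'a poly set)"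
  let ?Y = "\<Pi>\<^sub>E l\<in>{..<M}. (polys_below (J + D + k * l) :: 'a poly set)"
  \<comment> \<open>The tuple \<open>x\<close> holds the \<open>a j\<close> at indices below
    \<open>J\<close> and the \<open>b j\<close> at \<open>J + j\<close>.\<close>
  let ?C = "\<lambda>x. \<lambda>l\<in>{..<M}. local_coeff F V e J x (\<lambda>j. x (J + j)) l"
  have deg: "degree (x j) \<le> D" if "x \<in> ?X" "j < 2 * J" for x j
  proof -
    have "x j \<in> polys_below (Suc D)"
      using that by (auto simp: PiE_def)
    then show ?thesis
      by (simp add: polys_below_iff_degree)
  qed
  have "?C ` ?X \<subseteq> ?Y"
  proof (intro image_subsetI PiE_I)
    fix x l assume x: "x \<in> ?X" and l: "l \<in> {..<M}"
    have "degree (local_coeff F V e J x (\<lambda>j. x (J + j)) l) < J + D + k * l"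
      using deg[OF x] by (intro degree_local_coeff F V J) simp
    then show "?C x l \<in> polys_below (J + D + k * l)"
      using l J by (simp add: polys_below_iff_degree)
  qed simp
  moreover have "finite ?Y"
    by (intro finite_PiE) (simp_all add: polys_below_finite_card)
  ultimately have "card (?C ` ?X) \<le> card ?Y"
    by (rule card_mono[rotated])
  also have "\<dots> = ?Q ^ (\<Sum>l<M. J + D + k * l)"
    by (simp add: card_PiE polys_below_finite_card power_sum)
  also have "\<dots> < ?Q ^ (2 * J * Suc D)"
  proof (rule power_strict_increasing[OF count])
    have "card {0, 1 :: 'a} \<le> ?Q"
      by (intro card_mono) auto
    then show "1 < ?Q"
      by simp
  qed
  also have "\<dots> = card ?X"
    by (simp only: card_funcsetE finite_lessThan card_lessThan polys_below_finite_card
        power_mult[symmetric] mult.commute[of "2 * J" "Suc D"])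
  finally have "\<not> inj_on ?C ?X"
    by (rule pigeonhole)
  then obtain x y where xy: "x \<in> ?X" "y \<in> ?X" "x \<noteq> y" "?C x = ?C y"
    by (auto simp: inj_on_def)
  from xy have "\<exists>i<2 * J. x i \<noteq> y i"
    by (metis PiE_ext lessThan_iff)
  then obtain i where i: "i < 2 * J" "x i \<noteq> y i"
    by blast
  define a where "a j = (if j < J then x j - y j else 0)" for j
  define b where "b j = (if j < J then x (J + j) - y (J + j) else 0)" for j
  show ?thesis
  proof (rule that)
    show "degree (a j) \<le> D" "degree (b j) \<le> D" for j
      using deg[OF xy(1)] deg[OF xy(2)] by (auto simp: a_def b_def intro!: degree_diff_le)
    show "\<exists>j<J. a j \<noteq> 0 \<or> b j \<noteq> 0"
    proof (cases "i < J")
      case True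
      with i show ?thesis
        by (intro exI[of _ i]) (simp add: a_def)
    next
      case False
      with i show ?thesis
        by (intro exI[of _ "i - J"]) (simp add: b_def)
    qed
    fix l assume l: "l < M"
    have "local_coeff F V e J a b l
        = local_coeff F V e J (\<lambda>j. x j - y j) (\<lambda>j. x (J + j) - y (J + j)) l"
      unfolding local_coeff_def by (intro sum.cong) (simp_all add: a_def b_def)
    also have "\<dots> = 0"
      unfolding local_coeff_diff using fun_cong[OF xy(4), of l] l by simp
    finally show "local_coeff F V e J a b l = 0" .
  qed
qed

section \<open>Vanishing and nonvanishing of the auxiliary polynomial\<close>

lemma pcompose_power: "pcompose (f ^ n) h = pcompose f h ^ n" for h :: "'a::comm_ring_1 poly"
  by (induction n) (simp_all add: pcompose_mult pcompose_1)

lemma CHAR_poly_eq: "CHAR('a::comm_ring_1 poly) = CHAR('a)"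
  by (rule CHAR_eqI) (simp_all add: of_nat_poly of_nat_eq_0_iff_char_dvd)

text \<open>Substituting \<open>v + F(v) Z\<close> for \<open>X\<close> turns divisibility by a
  power of \<open>X - v\<close> into divisibility by \<open>Z ^ M\<close>, which is read off
  coefficientwise.\<close>

lemma stepanov_vanishing:
  fixes F :: "'a::field poly"
  assumes char: "prime CHAR('a)" "q = CHAR('a) ^ m" and "M \<le> q"
    and U: "expand F F = [:F:] * U"
    and zero: "\<And>l. l < M \<Longrightarrow> local_coeff F (U ^ N) e J a b l = 0"
    and v: "v ^ q = e * v" "poly F v ^ N = 1" "poly F v \<noteq> 0"
  shows "[:- v, 1:] ^ M dvd (\<Sum>j<J. monom 1 (q * j) * (a j + b j * F ^ N))" (is "_ dvd ?R")
proof -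
  let ?L = "[:v, poly F v:]"
  let ?E = "\<lambda>j. expand F (a j) + expand F (b j) * U ^ N"
  have F_L: "pcompose F ?L = [:poly F v:] * specialize v U"
    by (simp add: specialize_expand[symmetric] U)
  have "pcompose (a j + b j * F ^ N) ?L = specialize v (?E j)" for j
  proof -
    have "pcompose (F ^ N) ?L = [:poly F v ^ N:] * specialize v U ^ N"
      by (simp add: pcompose_power F_L smult_power)
    then show ?thesis
      using v by (simp add: pcompose_add pcompose_mult specialize_expand)
  qed
  then have T: "pcompose ?R ?L = (\<Sum>j<J. (?L ^ q) ^ j * specialize v (?E j))"
    by (simp add: pcompose_sum pcompose_mult monom_altdef pcompose_power power_mult pcompose_pCons)
  \<comment> \<open>By Frobenius, \<open>(v + F(v) Z) ^ q\<close> is \<open>e * v\<close> plus a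
    multiple of \<open>Z ^ q\<close>. Since \<open>M \<le> q\<close>, each
    \<open>X ^ (q * j)\<close> acts modulo \<open>Z ^ M\<close> as the constant
    \<open>(e * v) ^ j\<close>.\<close>
  have "?L = [:v:] + monom (poly F v) 1"
    by (simp add: monom_altdef)
  also have "\<dots> ^ q = [:v:] ^ q + monom (poly F v) 1 ^ q"
    by (rule freshmans_dream'[where n = m]) (simp_all add: CHAR_poly_eq char)
  also have "\<dots> = [:e * v:] + monom 1 M * monom (poly F v ^ q) (q - M)"
    using \<open>M \<le> q\<close> v(1) by (simp add: poly_const_pow monom_power mult_monom)
  finally have "monom 1 M dvd ?L ^ q - [:e * v:]"
    by simp
  moreover have "x - y dvd x ^ n - y ^ n" for x y :: "'a poly" and n
    by (simp add: power_diff_sumr2)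
  ultimately have "monom 1 M dvd (?L ^ q) ^ j - [:e * v:] ^ j" for j
    by (rule dvd_trans)
  then have "monom 1 M dvd (\<Sum>j<J. ((?L ^ q) ^ j - [:e * v:] ^ j) * specialize v (?E j))"
    by (intro dvd_sum) simp
  moreover have "monom 1 M dvd (\<Sum>j<J. [:e * v:] ^ j * specialize v (?E j))"
    unfolding monom_1_dvd_iff'
  proof (intro allI impI)
    fix l assume "l < M"
    have "coeff (\<Sum>j<J. [:e * v:] ^ j * specialize v (?E j)) l = poly (local_coeff F (U ^ N) e J a b l) v"
      by (simp add: local_coeff_def coeff_sum poly_sum poly_const_pow poly_monom power_mult_distrib
          del: specialize_add specialize_mult specialize_power)
    also have "\<dots> = 0"
      by (simp add: zero \<open>l < M\<close>)
    finally show "coeff (\<Sum>j<J. [:e * v:] ^ j * specialize v (?E j)) l = 0" .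
  qed
  ultimately have "monom 1 M dvd (\<Sum>j<J. ((?L ^ q) ^ j - [:e * v:] ^ j) * specialize v (?E j))
      + (\<Sum>j<J. [:e * v:] ^ j * specialize v (?E j))"
    by (rule dvd_add)
  also have "\<dots> = pcompose ?R ?L"
    unfolding T by (simp only: left_diff_distrib sum_subtractf diff_add_cancel)
  finally have "monom 1 M dvd pcompose ?R ?L" .
  then obtain G where G: "pcompose ?R ?L = monom 1 M * G"
    by blast
  \<comment> \<open>The inverse substitution, available because \<open>F(v) \<noteq> 0\<close>,
    carries \<open>Z\<close> back to a multiple of \<open>X - v\<close>.\<close>
  let ?L' = "[:- v / poly F v, 1 / poly F v:]"
  have "pcompose ?L ?L' = [:0, 1:]"
    using v(3) by (simp add: pcompose_pCons)
  then have "?R = pcompose (pcompose ?R ?L) ?L'"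
    by (simp flip: pcompose_assoc)
  also have "\<dots> = pcompose [:0, 1:] ?L' ^ M * pcompose G ?L'"
    unfolding G pcompose_mult by (simp add: monom_altdef pcompose_power)
  also have "pcompose [:0, 1:] ?L' = [:- v, 1:] * [:1 / poly F v:]"
    by (simp add: pcompose_pCons)
  finally show ?thesis
    by (simp only: power_mult_distrib mult.assoc dvd_triv_left)
qed

text \<open>If the sum vanished, its lowest nonzero block would be divisible by
  \<open>X ^ q\<close>. Modulo \<open>X ^ q\<close> one has \<open>F ^ q = 1\<close>, so
  \<open>F ^ N\<close> acts as an inverse square root of \<open>F\<close>. This gives
  \<open>a\<^sup>2 * F = b\<^sup>2\<close> modulo \<open>X ^ q\<close>, and exactly by the degree
  bound.\<close>

lemma stepanov_nonzero:
  fixes F :: "'a::field poly"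
  assumes char: "prime CHAR('a)" "q = CHAR('a) ^ m" and q: "q = Suc (2 * N)"
    and F: "poly F 0 = 1" "2 * D + degree F < q" "\<And>a b. a\<^sup>2 * F = b\<^sup>2 \<Longrightarrow> a = 0"
    and deg: "\<And>j. degree (a j) \<le> D" "\<And>j. degree (b j) \<le> D"
    and nz: "\<exists>j<J. a j \<noteq> 0 \<or> b j \<noteq> 0"
  shows "(\<Sum>j<J. monom 1 (q * j) * (a j + b j * F ^ N)) \<noteq> 0" (is "?R \<noteq> 0")
proof
  assume R: "?R = 0"
  let ?S = "\<lambda>j. a j + b j * F ^ N"
  define i where "i = (LEAST j. j < J \<and> (a j \<noteq> 0 \<or> b j \<noteq> 0))"
  have i: "i < J" "a i \<noteq> 0 \<or> b i \<noteq> 0"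
    using LeastI_ex[OF nz] by (auto simp: i_def)
  have less_i: "a j = 0 \<and> b j = 0" if "j < i" for j
    using not_less_Least[of j "\<lambda>j. j < J \<and> (a j \<noteq> 0 \<or> b j \<noteq> 0)"] that i(1) by (auto simp: i_def)
  have "monom 1 (q * i + q) dvd (\<Sum>j\<in>{..<J} - {i}. monom 1 (q * j) * ?S j)"
  proof (intro dvd_sum)
    fix j assume "j \<in> {..<J} - {i}"
    then consider "j < i" | "Suc i \<le> j"
      by force
    then show "monom 1 (q * i + q) dvd monom 1 (q * j) * ?S j"
    proof cases
      case 2
      then have "q * Suc i \<le> q * j"
        by (rule mult_le_mono2)
      then have "monom 1 (q * j) = monom 1 (q * i + q) * monom (1::'a) (q * j - (q * i + q))"
        by (simp add: mult_monom)
      then show ?thesis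
        by simp
    qed (simp add: less_i)
  qed
  also have "(\<Sum>j\<in>{..<J} - {i}. monom 1 (q * j) * ?S j) = monom 1 (q * i) * (- ?S i)"
    unfolding mult_minus_right using R i(1) by (simp add: sum_diff1)
  finally have "monom 1 (q * i) * monom 1 q dvd monom 1 (q * i) * (- ?S i)"
    by (simp only: mult_monom mult_1)
  then have S: "monom 1 q dvd ?S i"
    unfolding dvd_mult_cancel_left dvd_minus_iff by simp
  obtain G where G: "F = pCons 1 G"
    using F(1) by (cases F) auto
  have "F = 1 + monom 1 1 * G"
    by (simp add: G monom_altdef one_pCons)
  also have "\<dots> ^ q = 1 ^ q + (monom 1 1 * G) ^ q"
    by (rule freshmans_dream'[where n = m]) (simp_all add: CHAR_poly_eq char)
  finally have "F ^ q - 1 = monom 1 q * G ^ q"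
    by (simp add: power_mult_distrib monom_power)
  moreover have "F ^ q = F * (F ^ N)\<^sup>2"
    by (simp add: q mult.commute flip: power_mult)
  ultimately have "monom 1 q dvd F * (F ^ N)\<^sup>2 - 1"
    by simp
  moreover have "(a i)\<^sup>2 * F - (b i)\<^sup>2
      = ?S i * (F * (a i - b i * F ^ N)) + (b i)\<^sup>2 * (F * (F ^ N)\<^sup>2 - 1)"
    by (simp add: algebra_simps power2_eq_square)
  ultimately have "monom 1 q dvd (a i)\<^sup>2 * F - (b i)\<^sup>2"
    using S by simp
  moreover have "degree ((a i)\<^sup>2 * F - (b i)\<^sup>2) < q"
  proof (rule le_less_trans[OF degree_diff_le F(2)])
    show "degree ((a i)\<^sup>2 * F) \<le> 2 * D + degree F"
      using deg(1)[of i] by (intro order_trans[OF degree_mult_le] add_mono order_trans[OF degree_power_le]) simp_all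
    show "degree ((b i)\<^sup>2) \<le> 2 * D + degree F"
      using deg(2)[of i] by (intro order_trans[OF degree_power_le]) simp
  qed
  ultimately have "(a i)\<^sup>2 * F - (b i)\<^sup>2 = 0"
    using dvd_imp_degree_le[of "monom 1 q" "(a i)\<^sup>2 * F - (b i)\<^sup>2"] by (auto simp: degree_monom_eq)
  then have "(a i)\<^sup>2 * F = (b i)\<^sup>2"
    by simp
  from F(3)[OF this] this have "a i = 0" "b i = 0"
    by auto
  with i(2) show False
    by simp
qed

lemma stepanov:
  fixes F :: "'a::{field,finite} poly"
  assumes char: "q = CHAR('a) ^ m" and q: "q = Suc (2 * N)"
    and F: "poly F 0 = 1" "degree F = Suc k" "\<And>a b. a\<^sup>2 * F = b\<^sup>2 \<Longrightarrow> a = 0"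
    and pars: "2 * D + Suc k < q" "0 < J" "0 < M" "M \<le> q" "(\<Sum>l<M. J + D + k * l) < 2 * J * Suc D"
    and S: "\<And>v. v \<in> S \<Longrightarrow> v ^ q = e * v \<and> poly F v ^ N = 1"
  shows "card S * M \<le> q * (J - 1) + D + Suc k * N"
proof -
  have prime: "prime CHAR('a)"
    by (intro prime_CHAR_semidom finite_imp_CHAR_pos) simp
  obtain U where U: "expand F F = [:F:] * U" "weight_le k 0 U"
    using expand_self[OF F(2)] by blast
  from U(2) have "weight_le k 0 (U ^ N)"
    by (rule weight_le_power)
  from ex_local_coeffs_zero[OF eq_refl[OF F(2)] this pars(2,5)]
  obtain a b where ab: "\<And>j. degree (a j) \<le> D" "\<And>j. degree (b j) \<le> D" "\<exists>j<J. a j \<noteq> 0 \<or> b j \<noteq> 0"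
    "\<And>l. l < M \<Longrightarrow> local_coeff F (U ^ N) e J a b l = 0"
    by blast
  let ?R = "\<Sum>j<J. monom 1 (q * j) * (a j + b j * F ^ N)"
  \<comment> \<open>Positivity of \<open>N\<close> turns \<open>F(v) ^ N = 1\<close> into
    \<open>F(v) \<noteq> 0\<close>.\<close>
  have "N > 0"
    using q pars(1) by simp
  have "?R \<noteq> 0"
    using pars(1) F ab by (intro stepanov_nonzero[OF prime char q]) simp_all
  moreover have "[:- v, 1:] ^ M dvd ?R" if "v \<in> S" for v
    using S[OF that] \<open>N > 0\<close>
    by (intro stepanov_vanishing[OF prime char pars(4) U(1) ab(4)]) (auto simp: power_0_left)
  ultimately have "card S * M \<le> degree ?R"
    using pars(3) by (intro card_times_le_degree)
  also have "\<dots> \<le> q * (J - 1) + (D + Suc k * N)"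
  proof (intro degree_sum_le order_trans[OF degree_mult_le] add_mono degree_add_le)
    fix j assume j: "j \<in> {..<J}"
    then show "degree (monom (1::'a) (q * j)) \<le> q * (J - 1)"
      by (auto simp: degree_monom_eq)
    show "degree (a j) \<le> D + Suc k * N" "degree (b j) \<le> D"
      using ab(1,2)[of j] by simp_all
    show "degree (F ^ N) \<le> Suc k * N"
      using degree_power_le[of F N] by (simp only: F(2))
  qed simp
  finally show ?thesis
    by simp
qed

text \<open>Descent as for Pell's equation: with \<open>F = W\<^sup>2 - \<kappa>\<close>,
  multiplying \<open>b + a sqrt(F)\<close> by \<open>W - sqrt(F)\<close> gives a solution with
  \<open>a * W - b\<close> in place of \<open>a\<close>. For one sign of \<open>b\<close> this has
  smaller degree.\<close>

lemma square_minus_const_not_square: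
  fixes W :: "'a::field poly"
  assumes "degree W > 0" "\<kappa> \<noteq> 0" "(2::'a) \<noteq> 0" and "a\<^sup>2 * (W\<^sup>2 - [:\<kappa>:]) = b\<^sup>2"
  shows "a = 0"
  using assms(4)
proof (induction "degree a" arbitrary: a b rule: less_induct)
  case less
  show ?case
  proof (rule ccontr)
    assume a: "a \<noteq> 0"
    have small: False if deg: "degree (a * W - b) < degree a" and eq: "a\<^sup>2 * (W\<^sup>2 - [:\<kappa>:]) = b\<^sup>2" for b
    proof -
      let ?F = "W\<^sup>2 - [:\<kappa>:]"
      have "(W * b - ?F * a)\<^sup>2 - (a * W - b)\<^sup>2 * ?F = (b\<^sup>2 - a\<^sup>2 * ?F) * [:\<kappa>:]"
        by (simp only: power2_eq_square) algebra
      then have "(a * W - b)\<^sup>2 * ?F = (W * b - ?F * a)\<^sup>2"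
        using eq by simp
      then have "a * W - b = 0"
        using less.hyps[OF deg] by blast
      then have b: "b = a * W"
        by simp
      have "a\<^sup>2 * [:\<kappa>:] = (a * W)\<^sup>2 - a\<^sup>2 * (W\<^sup>2 - [:\<kappa>:])"
        by (simp only: power_mult_distrib right_diff_distrib diff_diff_eq2 add_diff_cancel_left')
      also have "\<dots> = 0"
        unfolding eq b by simp
      finally have "a\<^sup>2 * [:\<kappa>:] = 0" .
      with a assms(2) show False
        by simp
    qed
    have prod: "(a * W - b) * (a * W + b) = smult \<kappa> (a\<^sup>2)"
    proof -
      have "(a * W - b) * (a * W + b) = a\<^sup>2 * (W\<^sup>2 - [:\<kappa>:]) - b\<^sup>2 + a\<^sup>2 * [:\<kappa>:]"
        by (simp add: algebra_simps power2_eq_square)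
      then show ?thesis
        using less.prems by simp
    qed
    then have nz: "a * W - b \<noteq> 0" "a * W + b \<noteq> 0"
      using a assms(2) by auto
    \<comment> \<open>The factor degrees add up to \<open>2 * degree a\<close>, but the sum of the
      factors has degree above \<open>degree a\<close>. So one factor lies above
      \<open>degree a\<close> and the other below.\<close>
    have "degree (a * W - b) + degree (a * W + b) = 2 * degree a"
      using degree_mult_eq[OF nz] prod a assms(2) by (simp add: degree_power_eq)
    moreover have "(a * W - b) + (a * W + b) = 2 * (a * W)"
      by (simp add: algebra_simps)
    then have "(a * W - b) + (a * W + b) = smult 2 (a * W)"
      unfolding numeral_mult_conv_smult .
    then have "degree a + degree W \<le> max (degree (a * W - b)) (degree (a * W + b))"
      using degree_add_le_max[of "a * W - b" "a * W + b"] a assms(1,3)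
      by (cases "W = 0") (auto simp: degree_mult_eq)
    ultimately have "degree (a * W - b) < degree a \<or> degree (a * W - (- b)) < degree a"
      using assms(1) by auto
    then show False
      using small[of b] small[of "- b"] less.prems by auto
  qed
qed

section \<open>Arithmetic in simple extensions of prime fields\<close>

text \<open>
  A list \<open>[c\<^sub>0, \<dots>, c\<^bsub>n-1\<^esub>]\<close> of integers modulo \<open>p\<close> stands for \<open>\<Sum>\<^sub>i c\<^sub>i x\<^sup>i\<close>, where \<open>x\<^sup>n = r\<close>.
\<close>

definition shift_list :: "int \<Rightarrow> int \<Rightarrow> int list \<Rightarrow> int list" where
  "shift_list p r ys = r * last ys mod p # butlast ys"

text \<open>Horner's scheme in the first factor; \<open>shift_list\<close> is multiplication by
  \<open>x\<close>.\<close>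

fun mult_list :: "int \<Rightarrow> int \<Rightarrow> int list \<Rightarrow> int list \<Rightarrow> int list" where
  "mult_list p r [] ys = map (\<lambda>_. 0) ys"
| "mult_list p r (c # cs) ys = map2 (\<lambda>a b. (c * a + b) mod p) ys (shift_list p r (mult_list p r cs ys))"

function power_list :: "int \<Rightarrow> int \<Rightarrow> int list \<Rightarrow> int \<Rightarrow> int list" where
  "power_list p r ys k = (if k \<le> 0 then 1 # map (\<lambda>_. 0) (tl ys)
     else let zs = power_list p r ys (k div 2); zs2 = mult_list p r zs zs
       in if k mod 2 = 0 then zs2 else mult_list p r ys zs2)"
  by auto
termination
  by (relation "measure (\<lambda>(p, r, ys, k). nat k)") auto

declare power_list.simps [simp del]

definition affine_list :: "int \<Rightarrow> int \<Rightarrow> int \<Rightarrow> int list \<Rightarrow> int list" where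
  "affine_list p a b ys = (a * hd ys + b) mod p # map (\<lambda>c. a * c mod p) (tl ys)"

text \<open>Euler's criterion for the hypotheses of \<open>ex_witness_of_square\<close>, where
  \<open>w = 1 - z\<close> and \<open>const (p - 1)\<close> encodes -1. The test on \<open>r\<close>
  provides an \<open>n\<close>-th root \<open>x\<close>; the last test says that
  \<open>3 * z \<noteq> 1\<close>.\<close>

definition certificate :: "int \<Rightarrow> int \<Rightarrow> int list \<Rightarrow> bool" where
  "certificate p r zs \<longleftrightarrow>
    (let n = int (length zs); q = p ^ length zs; N = (q - 1) div 2;
         const = (\<lambda>c. c # map (\<lambda>_. 0) (tl zs)); w = affine_list p (-1) 1 zs in
     zs \<noteq> [] \<and> (q - 1) mod n = 0 \<and> power_list p 0 [r] ((q - 1) div n) = [1]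
     \<and> power_list p r zs N = const (p - 1)
     \<and> power_list p r (affine_list p (-3) 4 zs) N = const (p - 1)
     \<and> power_list p r (affine_list p 1 (-12) (mult_list p r zs (mult_list p r w w))) N = const 1
     \<and> power_list p r (affine_list p 3 (-1) zs) (2 * N) = const 1)"

text \<open>
  An entry \<open>(p, r, z)\<close> treats \<open>q = p\<^sup>n\<close> for the length \<open>n\<close> of \<open>z\<close>; it provides the square \<open>z\<close> of \<open>s\<close> in a \<open>witness\<close>.
\<close>

definition certificates :: "(int \<times> int \<times> int list) list" where
  "certificates =
    [(13, 1, [2]), (31, 1, [6]), (37, 1, [2]), (43, 1, [5]), (7, 3, [1, 2]), (61, 1, [7]), (67, 1, [7]),
     (73, 1, [20]), (79, 1, [12]), (97, 1, [10]), (103, 1, [11]), (109, 1, [6]), (11, 2, [1, 4]), (127,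
     1, [5]), (139, 1, [15]), (151, 1, [12]), (157, 1, [2]), (163, 1, [19]), (13, 2, [0, 1]), (181, 1,
     [7]), (193, 1, [19]), (199, 1, [12]), (211, 1, [8]), (223, 1, [6]), (229, 1, [21]), (241, 1, [7]),
     (271, 1, [6]), (277, 1, [2]), (283, 1, [14]), (17, 3, [0, 1]), (307, 1, [5]), (331, 1, [8]), (337,
     1, [19]), (7, 2, [0, 3, 0]), (349, 1, [13]), (19, 2, [1, 1]), (367, 1, [10]), (373, 1, [2]), (379,
     1, [8]), (397, 1, [2]), (409, 1, [11]), (421, 1, [6]), (433, 1, [20]), (439, 1, [6]), (457, 1, [5]),
     (463, 1, [7]), (487, 1, [13]), (499, 1, [10]), (523, 1, [5]), (23, 5, [1, 11]), (541, 1, [24]),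
     (547, 1, [20]), (571, 1, [28]), (577, 1, [20]), (601, 1, [7]), (607, 1, [6]), (613, 1, [2]), (619,
     1, [14]), (631, 1, [11])]"

lemma certificates_valid: "list_all (\<lambda>(p, r, zs). certificate p r zs) certificates"
  by code_simp

text \<open>The range reaches \<open>q = 637\<close>. A proper divisor coprime to its cofactor
  excludes a prime power; 25 and 625 are left to the assumption \<open>p > 5\<close>.\<close>

lemma certificates_complete:
  "list_all (\<lambda>k. let q = 6 * k + 1 in
     q \<in> {1, 7, 19, 25, 313, 625} \<or> list_ex (\<lambda>(p, r, zs). q = p ^ length zs) certificates
     \<or> list_ex (\<lambda>d. d < q \<and> q mod d = 0 \<and> gcd d (q div d) = 1) [5, 7, 11, 13, 17, 19, 23, 25])
   [0..106]"
  by code_simp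

section \<open>Correctness of the list arithmetic\<close>

lemma length_shift_list [simp]: "ys \<noteq> [] \<Longrightarrow> length (shift_list p r ys) = length ys"
  by (simp add: shift_list_def)

lemma length_mult_list [simp]: "length (mult_list p r xs ys) = length ys"
proof (induction xs)
  case (Cons c cs)
  show ?case
  proof (cases "ys = []")
    case False
    with Cons have "mult_list p r cs ys \<noteq> []"
      by force
    with Cons show ?thesis
      by simp
  qed simp
qed simp

lemma mult_list_eq_Nil_iff [simp]: "mult_list p r xs ys = [] \<longleftrightarrow> ys = []"
  using length_mult_list[of p r xs ys] by (cases ys) (auto simp del: length_mult_list)

lemma length_power_list [simp]: "ys \<noteq> [] \<Longrightarrow> length (power_list p r ys k) = length ys"
  by (induction p r ys k rule: power_list.induct) (subst power_list.simps, auto simp: Let_def)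

lemma length_affine_list [simp]: "ys \<noteq> [] \<Longrightarrow> length (affine_list p a b ys) = length ys"
  by (simp add: affine_list_def)

locale list_arith =
  fixes p r :: int and x :: "'a::field" and n :: nat
  assumes of_int_p: "of_int p = (0::'a)" and x_power: "x ^ n = of_int r" and n_pos: "n > 0"
begin

abbreviation val :: "int list \<Rightarrow> 'a" where
  "val \<equiv> horner_sum of_int x"

lemma of_int_mod: "of_int (a mod p) = (of_int a :: 'a)"
proof -
  have "of_int a = (of_int (p * (a div p) + a mod p) :: 'a)"
    by simp
  also have "\<dots> = of_int (a mod p)"
    by (simp only: of_int_add of_int_mult of_int_p mult_zero_left add_0_left)
  finally show ?thesis ..
qed

lemma val_snoc: "val (ys @ [c]) = val ys + x ^ length ys * of_int c"
  by (induction ys) (simp_all add: algebra_simps)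

lemma val_shift:
  assumes "length ys = n"
  shows "val (shift_list p r ys) = x * val ys"
proof -
  have "ys \<noteq> []"
    using assms n_pos by auto
  then obtain us c where ys: "ys = us @ [c]"
    by (metis rev_exhaust)
  with assms have "n = Suc (length us)"
    by simp
  with x_power have r: "x * x ^ length us = of_int r"
    by simp
  show ?thesis
    unfolding ys val_snoc distrib_left mult.assoc[symmetric] r by (simp add: shift_list_def of_int_mod)
qed

lemma val_map2:
  "length ys = length zs \<Longrightarrow> val (map2 (\<lambda>a b. (c * a + b) mod p) ys zs) = of_int c * val ys + val zs"
  by (induction ys zs rule: list_induct2) (simp_all add: of_int_mod algebra_simps)

lemma val_zeros: "val (map (\<lambda>_. 0) ys) = 0"
  by (induction ys) simp_all

lemma val_mult: "length ys = n \<Longrightarrow> val (mult_list p r xs ys) = val xs * val ys"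
proof (induction xs)
  case Nil
  then show ?case
    by (simp add: val_zeros)
next
  case (Cons c cs)
  moreover from this have "mult_list p r cs ys \<noteq> []"
    using n_pos by auto
  ultimately show ?case
    unfolding mult_list.simps by (subst val_map2) (simp_all add: val_shift algebra_simps)
qed


lemma val_power: "length ys = n \<Longrightarrow> val (power_list p r ys k) = val ys ^ nat k"
proof (induction "nat k" arbitrary: k rule: less_induct)
  case less
  show ?case
  proof (cases "k \<le> 0")
    case True
    then show ?thesis
      by (subst power_list.simps) (simp add: val_zeros)
  next
    case False
    have "ys \<noteq> []"
      using less.prems n_pos by auto
    define zs where "zs = power_list p r ys (k div 2)"
    have zs: "length zs = n" "val zs = val ys ^ nat (k div 2)"
      using less.hyps[of "k div 2"] less.prems \<open>ys \<noteq> []\<close> False by (simp_all add: zs_def)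
    have "nat k = 2 * nat (k div 2) + nat (k mod 2)"
      using False by (simp add: nat_div_distrib nat_mod_distrib)
    moreover have "k mod 2 = 0 \<or> k mod 2 = 1"
      by presburger
    moreover have "power_list p r ys k
        = (if k mod 2 = 0 then mult_list p r zs zs else mult_list p r ys (mult_list p r zs zs))"
      using False by (subst power_list.simps) (simp add: zs_def Let_def)
    ultimately show ?thesis
      using less.prems zs by (auto simp: val_mult power_add mult_2)
  qed
qed

lemma val_affine:
  assumes "ys \<noteq> []"
  shows "val (affine_list p a b ys) = of_int a * val ys + of_int b"
proof -
  have "val (map (\<lambda>c. a * c mod p) us) = of_int a * val us" for us
    by (induction us) (simp_all add: of_int_mod algebra_simps)
  with assms show ?thesis
    by (cases ys) (simp_all add: affine_list_def of_int_mod algebra_simps)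
qed

end

section \<open>Conjugation in a quadratic extension\<close>

locale quad_ext =
  fixes p m q :: nat and cj :: "'a::{field,finite} \<Rightarrow> 'a"
  assumes prime_p: "prime p" and p_gt_5: "p > 5" and q_eq: "q = p ^ m"
    and q_mod_6: "q mod 6 = 1" and CARD_eq: "card (UNIV :: 'a set) = q\<^sup>2"
    and cj_eq: "cj x = x ^ q"
begin

section \<open>Characteristic, conjugation and square roots\<close>

lemma q_ge_7: "q \<ge> 7"
proof -
  have "q \<noteq> 1"
  proof
    assume "q = 1"
    with CARD_eq have "card (UNIV :: 'a set) = 1"
      by simp
    then show False
      by (metis UNIV_I card_1_singletonE singletonD zero_neq_one)
  qed
  moreover have "q \<noteq> 0"
    using q_mod_6 by auto
  ultimately show ?thesis
    using q_mod_6 by presburger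
qed

lemma even_q_minus_1: "2 * ((q - 1) div 2) = q - 1"
  using q_mod_6 by presburger

lemma CHAR_a: "CHAR('a) = p"
proof -
  have "CHAR('a) > 0"
    by (intro finite_imp_CHAR_pos) simp
  then have "prime CHAR('a)"
    by (rule prime_CHAR_semidom)
  \<comment> \<open>Translation by 1 permutes the field, so the field's cardinality is zero in
    it.\<close>
  moreover have "(\<Sum>x\<in>UNIV. x + 1) = (\<Sum>x\<in>UNIV. x :: 'a)"
    by (rule sum.reindex_bij_witness[of _ "\<lambda>x. x - 1" "\<lambda>x. x + 1"]) auto
  then have "of_nat (card (UNIV :: 'a set)) = (0::'a)"
    by (simp add: sum.distrib)
  then have "CHAR('a) dvd q\<^sup>2"
    by (simp only: of_nat_eq_0_iff_char_dvd CARD_eq)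
  ultimately show ?thesis
    using prime_p q_eq by (metis prime_dvd_power primes_dvd_imp_eq)
qed

lemma of_nat_eq_0: "(of_nat k :: 'a) = 0 \<longleftrightarrow> p dvd k"
  by (simp add: of_nat_eq_0_iff_char_dvd CHAR_a)

lemma numeral_nonzero [simp]: "(2::'a) \<noteq> 0" "(3::'a) \<noteq> 0" "(5::'a) \<noteq> 0"
  using of_nat_eq_0[of 2] of_nat_eq_0[of 3] of_nat_eq_0[of 5] p_gt_5
  by (auto dest: dvd_imp_le)

lemma numeral_Bit0_eq_0 [simp]: "(numeral (num.Bit0 k) :: 'a) = 0 \<longleftrightarrow> (numeral k :: 'a) = 0" "(9::'a) \<noteq> 0"
proof -
  have "(numeral (num.Bit0 k) :: 'a) = 2 * numeral k" "(9::'a) = 3 * 3"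
    by simp_all
  then show "(numeral (num.Bit0 k) :: 'a) = 0 \<longleftrightarrow> (numeral k :: 'a) = 0" "(9::'a) \<noteq> 0"
    using no_zero_divisors[of "3::'a" 3] by (simp_all only: mult_eq_0_iff numeral_nonzero simp_thms)
qed

lemma cj_add [simp]: "cj (x + y) = cj x + cj y"
  unfolding cj_eq by (rule freshmans_dream'[where n = m]) (simp_all add: CHAR_a prime_p q_eq)

lemma cj_mult [simp]: "cj (x * y) = cj x * cj y"
  by (simp add: cj_eq power_mult_distrib)

lemma cj_minus [simp]: "cj (- x) = - cj x"
proof -
  have "odd q"
    using q_mod_6 by presburger
  then show ?thesis
    by (simp add: cj_eq)
qed

lemma cj_diff [simp]: "cj (x - y) = cj x - cj y"
  using cj_add[of x "- y"] by simp

lemma cj_power [simp]: "cj (x ^ n) = cj x ^ n"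
  by (simp add: cj_eq mult.commute flip: power_mult)

lemma cj_divide [simp]: "cj (x / y) = cj x / cj y"
  by (simp add: cj_eq power_divide)

lemma cj_0 [simp]: "cj 0 = 0"
  using q_ge_7 by (simp add: cj_eq)

lemma cj_1 [simp]: "cj 1 = 1"
  by (simp add: cj_eq)

lemma cj_of_nat [simp]: "cj (of_nat k) = of_nat k"
  by (induction k) simp_all

lemma cj_numeral [simp]: "cj (numeral k) = numeral k"
  using cj_of_nat[of "numeral k"] by simp

lemma cj_of_int [simp]: "cj (of_int k) = of_int k"
  by (cases k) simp_all

lemma cj_cj [simp]: "cj (cj x) = x"
  using finite_field_power_card[of x] by (simp add: cj_eq CARD_eq power2_eq_square power_mult)

lemma cj_eq_0 [simp]: "cj x = 0 \<longleftrightarrow> x = 0"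
  by (metis cj_0 cj_cj)

text \<open>The map \<open>cj x - x\<close> has fibres of at most \<open>q\<close> elements, so its
  range has at least \<open>q\<close>, and \<open>cj\<close> negates all its values.\<close>

lemma card_cj_eq_minus: "card {v. cj v = - v} \<ge> q"
proof -
  let ?f = "\<lambda>x. cj x - x"
  have "card {x \<in> UNIV. ?f x = y} \<le> q" for y
  proof (rule card_le_degree[of "monom 1 q - [:y, 1:]"])
    show "coeff (monom 1 q - [:y, 1:]) q \<noteq> 0" "degree (monom 1 q - [:y, 1:]) \<le> q"
      using q_ge_7 by (auto simp: coeff_pCons split: nat.split intro!: degree_diff_le degree_monom_le)
  qed (auto simp: poly_monom cj_eq)
  then have "q * q \<le> q * card (range ?f)"
    using card_le_fibres[of UNIV ?f q] by (simp add: CARD_eq power2_eq_square)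
  then have "q \<le> card (range ?f)"
    using q_ge_7 by simp
  also have "\<dots> \<le> card {v. cj v = - v}"
    by (intro card_mono) auto
  finally show ?thesis .
qed

lemma card_cj_eq_self: "card {v. cj v = v} \<ge> q"
proof -
  let ?f = "\<lambda>x. cj x + x"
  have "card {x \<in> UNIV. ?f x = y} \<le> q" for y
  proof (rule card_le_degree[of "monom 1 q + [:-y, 1:]"])
    show "coeff (monom 1 q + [:-y, 1:]) q \<noteq> 0" "degree (monom 1 q + [:-y, 1:]) \<le> q"
      using q_ge_7 by (auto simp: coeff_pCons split: nat.split intro!: degree_add_le degree_monom_le)
  qed (auto simp: poly_monom cj_eq)
  then have "q * q \<le> q * card (range ?f)"
    using card_le_fibres[of UNIV ?f q] by (simp add: CARD_eq power2_eq_square)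
  then have "q \<le> card (range ?f)"
    using q_ge_7 by simp
  also have "\<dots> \<le> card {v. cj v = v}"
    by (intro card_mono) (auto simp: add.commute)
  finally show ?thesis .
qed

text \<open>Since \<open>q \<equiv> 1 (mod 3)\<close>, the fixed field of \<open>cj\<close> contains the cube roots of unity.\<close>

lemma ex_sqrt_minus_3: "\<exists>t. t\<^sup>2 = -3 \<and> cj t = t"
proof -
  define k where "k = (q - 1) div 3"
  have k: "q = Suc (k * 3)" "k > 0"
    using q_mod_6 q_ge_7 unfolding k_def by presburger+
  have "card ({v. cj v = v} - {0}) \<ge> q - 1"
    using card_cj_eq_self by (simp add: card_Diff_singleton)
  then have "card ({v. cj v = v} - {0}) > k"
    using k by linarith
  moreover have "card {x \<in> {v. cj v = v} - {0}. x ^ k = 1} \<le> k"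
    using k by (intro card_nth_roots_le)
  ultimately have "{x \<in> {v. cj v = v} - {0}. x ^ k = 1} \<noteq> {v. cj v = v} - {0}"
    by (metis linorder_not_less)
  then obtain x where x: "cj x = x" "x \<noteq> 0" "x ^ k \<noteq> 1"
    by blast
  \<comment> \<open>\<open>w\<close> is a primitive cube root of unity, so \<open>2 * w + 1\<close>
    is a square root of -3.\<close>
  define w where "w = x ^ k"
  have "x * w ^ 3 = cj x"
    unfolding cj_eq k(1) w_def power_Suc by (simp only: power_mult)
  with x have "w ^ 3 = 1"
    by simp
  moreover have "(w - 1) * (w\<^sup>2 + w + 1) = w ^ 3 - 1"
    by (simp add: algebra_simps power2_eq_square power3_eq_cube)
  ultimately have "w\<^sup>2 + w + 1 = 0"
    using x by (simp add: w_def)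
  moreover have "(2 * w + 1)\<^sup>2 = 4 * (w\<^sup>2 + w + 1) - 3"
    by (simp add: algebra_simps power2_eq_square)
  ultimately have "(2 * w + 1)\<^sup>2 = -3"
    by simp
  moreover have "cj (2 * w + 1) = 2 * w + 1"
    using x by (simp add: w_def)
  ultimately show ?thesis
    by blast
qed

text \<open>Half the order of the multiplicative group is a multiple of \<open>q - 1\<close>, and
  \<open>x ^ (q - 1) = 1\<close> for nonzero fixed \<open>x\<close>.\<close>

lemma ex_sqrt_fixed:
  assumes "cj x = x" "x \<noteq> 0"
  shows "\<exists>y. y\<^sup>2 = x"
proof (rule ex_nth_root)
  have "x ^ (q - 1) * x = cj x"
    unfolding cj_eq using q_ge_7 by (intro power_minus_mult) simp
  then have "x ^ (q - 1) = 1"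
    using assms by simp
  then show "x ^ ((q - 1) * ((q + 1) div 2)) = 1"
    by (simp add: power_mult)
  have "2 * ((q + 1) div 2) = q + 1"
    using q_mod_6 by presburger
  then show *: "2 * ((q - 1) * ((q + 1) div 2)) = card (UNIV :: 'a set) - 1"
    by (simp add: CARD_eq power2_eq_square algebra_simps)
  show "0 < 2 * ((q - 1) * ((q + 1) div 2))"
    unfolding * CARD_eq using q_ge_7 power_strict_mono[of 1 q 2] by simp
qed

text \<open>Euler's criterion: the power of \<open>y\<^sup>2\<close> is the sign by which
  conjugation acts on a square root of a nonzero fixed element.\<close>

lemma cj_sqrt: "cj y = y * (y\<^sup>2) ^ ((q - 1) div 2)"
proof -
  have "(y\<^sup>2) ^ ((q - 1) div 2) * y = y ^ (q - 1) * y"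
    by (simp only: even_q_minus_1 flip: power_mult)
  also have "\<dots> = cj y"
    unfolding cj_eq using q_ge_7 by (intro power_minus_mult) simp
  finally show ?thesis
    by (simp add: mult.commute)
qed

section \<open>Fibres of \<open>g\<close>\<close>

lemma eq_neg_self_iff: "x = - x \<longleftrightarrow> x = (0::'a)" "- x = x \<longleftrightarrow> x = 0"
proof -
  show "x = - x \<longleftrightarrow> x = 0"
    by (simp add: eq_neg_iff_add_eq_0 flip: mult_2)
  then show "- x = x \<longleftrightarrow> x = 0"
    by (simp only: eq_commute[of "- x"])
qed

text \<open>With a fixed square root \<open>t\<close> of -3, \<open>d\<close> equals
  \<open>t * s\<close> up to sign and is therefore fixed as well as negated by
  \<open>cj\<close>.\<close>

lemma anisotropic:
  assumes "cj s = s" "cj d = - d" "3 * s\<^sup>2 + d\<^sup>2 = 0"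
  shows "s = 0 \<and> d = 0"
proof -
  obtain t where t: "t\<^sup>2 = -3" "cj t = t"
    using ex_sqrt_minus_3 by blast
  have "d\<^sup>2 = (t * s)\<^sup>2"
    using assms(3) by (simp add: power_mult_distrib t) (metis add_eq_0_iff)
  then have "d = t * s \<or> d = - (t * s)"
    by (simp add: power2_eq_iff)
  then have "cj d = d"
    using t assms(1) by auto
  with assms(2) have "d = 0"
    by (simp add: eq_neg_self_iff)
  with assms(3) show ?thesis
    by simp
qed

lemma quadratic_form_eq:
  assumes "z\<^sup>2 + 2 * z * cj z = w\<^sup>2 + 2 * w * cj w"
  shows "w = z \<or> w = - z"
proof -
  define s d s' d' where defs: "s = z + cj z" "d = z - cj z" "s' = w + cj w" "d' = w - cj w"
  have zw: "2 * z = s + d" "2 * w = s' + d'"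
    by (simp_all add: defs)
  have cjs: "cj s = s" "cj d = - d" "cj s' = s'" "cj d' = - d'"
    by (simp_all add: defs add.commute)
  from arg_cong[OF assms, of cj]
  have assms': "(cj z)\<^sup>2 + 2 * cj z * z = (cj w)\<^sup>2 + 2 * cj w * w"
    by simp
  have "s * d = (z\<^sup>2 + 2 * z * cj z) - ((cj z)\<^sup>2 + 2 * cj z * z)"
    "s' * d' = (w\<^sup>2 + 2 * w * cj w) - ((cj w)\<^sup>2 + 2 * cj w * w)"
    by (simp_all add: defs algebra_simps power2_eq_square)
  then have sd: "s * d = s' * d'"
    by (simp only: assms assms')
  have "3 * s\<^sup>2 - d\<^sup>2 = 2 * (z\<^sup>2 + 2 * z * cj z) + 2 * ((cj z)\<^sup>2 + 2 * cj z * z)"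
    "3 * s'\<^sup>2 - d'\<^sup>2 = 2 * (w\<^sup>2 + 2 * w * cj w) + 2 * ((cj w)\<^sup>2 + 2 * cj w * w)"
    by (simp_all add: defs algebra_simps power2_eq_square)
  then have diff: "3 * s\<^sup>2 - d\<^sup>2 = 3 * s'\<^sup>2 - d'\<^sup>2"
    by (simp only: assms assms')
  \<comment> \<open>The equation and its conjugate yield \<open>sd\<close> and \<open>diff\<close>;
    eliminating \<open>d\<close> gives this factorisation. By \<open>anisotropic\<close>, a
    vanishing second factor forces all four quantities to be zero.\<close>
  have "(s\<^sup>2 - s'\<^sup>2) * (3 * s\<^sup>2 + d'\<^sup>2)
      = s\<^sup>2 * ((3 * s\<^sup>2 - d\<^sup>2) - (3 * s'\<^sup>2 - d'\<^sup>2)) + ((s * d)\<^sup>2 - (s' * d')\<^sup>2)"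
    by (simp add: algebra_simps power2_eq_square)
  also have "\<dots> = 0"
    by (simp add: sd diff)
  finally consider "3 * s\<^sup>2 + d'\<^sup>2 = 0" | "s\<^sup>2 = s'\<^sup>2"
    by auto
  then have "(s' = s \<and> d' = d) \<or> (s' = - s \<and> d' = - d)"
  proof cases
    case 1
    then have "s = 0" "d' = 0"
      using anisotropic cjs by blast+
    moreover from this diff have "3 * s'\<^sup>2 + d\<^sup>2 = 0"
      by (simp add: eq_neg_iff_add_eq_0) (metis add.commute add_eq_0_iff)
    then have "s' = 0" "d = 0"
      using anisotropic cjs by blast+
    ultimately show ?thesis
      by simp
  next
    case 2
    with diff have "d\<^sup>2 = d'\<^sup>2"
      by simp
    with 2 have "s' = s \<or> s' = - s" "d' = d \<or> d' = - d"
      by (auto simp: power2_eq_iff)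
    with sd show ?thesis
      by (auto simp: eq_neg_self_iff)
  qed
  then have "2 * w = 2 * z \<or> 2 * w = 2 * (- z)"
    unfolding mult_minus_right zw by auto
  then show ?thesis
    using numeral_nonzero(1) mult_left_cancel by blast
qed

section \<open>Reduction of boomerang counts to fibres of \<open>g\<close>\<close>

definition g :: "'a \<Rightarrow> 'a" where
  "g t = t\<^sup>2 * cj t + 2 * t + cj t"

definition f :: "'a \<Rightarrow> 'a" where
  "f x = x\<^sup>2 * cj x"

lemma f_eq_power: "f = (\<lambda>x. x ^ (q + 2))"
  by (rule ext) (simp add: f_def cj_eq power_add mult.commute del: add_2_eq_Suc')

lemma f_divide: "f (x / y) = f x / f y"
  by (simp add: f_def power_divide)

lemma f_eq_0 [simp]: "f x = 0 \<longleftrightarrow> x = 0"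
  by (auto simp: f_def)

lemma boomerang_count_scale:
  assumes "a \<noteq> 0"
  shows "boomerang_count f a b = boomerang_count f 1 (b / f a)"
proof -
  have *: "f (x / a) - f (y / a) = b / f a \<longleftrightarrow> f x - f y = b" for x y
    using assms by (simp add: f_divide flip: diff_divide_distrib)
  have **: "x / a + 1 = (x + a) / a" for x
    using assms by (simp add: add_divide_distrib)
  let ?h = "\<lambda>(x, y). (x / a, y / a)"
  have "inj ?h"
    using assms by (auto simp: inj_on_def)
  moreover have "surj ?h"
    using assms by (intro surjI[of _ "\<lambda>(x, y). (x * a, y * a)"]) auto
  ultimately have "card (?h -` {(x, y). f x - f y = b / f a \<and> f (x + 1) - f (y + 1) = b / f a})
      = card {(x, y). f x - f y = b / f a \<and> f (x + 1) - f (y + 1) = b / f a}"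
    by (intro card_vimage_inj) auto
  moreover have "?h -` {(x, y). f x - f y = b / f a \<and> f (x + 1) - f (y + 1) = b / f a}
      = {(x, y). f x - f y = b \<and> f (x + a) - f (y + a) = b}"
    by (rule set_eqI) (simp only: vimage_eq split_paired_all mem_Collect_eq case_prod_conv * **)
  ultimately show ?thesis
    by (simp only: boomerang_count_def)
qed

text \<open>Centring at \<open>z = 2 * x + 1\<close> puts \<open>x\<close> and \<open>x + 1\<close>
  at \<open>(z - 1) / 2\<close> and \<open>(z + 1) / 2\<close>, so the shift becomes a change of
  sign.\<close>

lemma f_half: "8 * f ((z - 1) / 2) = (z - 1)\<^sup>2 * (cj z - 1)"
  "8 * f ((z - 1) / 2 + 1) = (z + 1)\<^sup>2 * (cj z + 1)"
proof -
  show "8 * f ((z - 1) / 2) = (z - 1)\<^sup>2 * (cj z - 1)"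
    by (simp add: f_def power_divide)
  have *: "(z - 1) / 2 + 1 = (z + 1) / 2"
    by (simp add: field_simps)
  show "8 * f ((z - 1) / 2 + 1) = (z + 1)\<^sup>2 * (cj z + 1)"
    unfolding * by (simp add: f_def power_divide)
qed

lemma boomerang_count_eq_card_fibre:
  assumes "b \<noteq> 0"
  shows "boomerang_count f 1 b = card {t. g t = 4 * b}"
proof -
  let ?A = "{(x, y). f x - f y = b \<and> f (x + 1) - f (y + 1) = b}"
  let ?h = "\<lambda>t. ((t - 1) / 2, (- t - 1) / 2)"
  have eight: "(8::'a) \<noteq> 0"
    by simp
  have g_diff: "8 * (f ((t - 1) / 2) - f ((- t - 1) / 2)) = 2 * g t"
    "8 * (f ((t - 1) / 2 + 1) - f ((- t - 1) / 2 + 1)) = 2 * g t" for t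
    unfolding right_diff_distrib f_half g_def by (simp_all add: algebra_simps power2_eq_square)
  have iff: "x = b \<longleftrightarrow> 8 * x = 2 * (4 * b)" for x
    using mult_left_cancel[OF eight, of x b] by simp
  have "?A = ?h ` {t. g t = 4 * b}"
  proof (intro equalityI subsetI)
    fix u assume "u \<in> ?A"
    then obtain x y where u: "u = (x, y)" and xy: "f x - f y = b" "f (x + 1) - f (y + 1) = b"
      by blast
    define z w where zw: "z = 2 * x + 1" "w = 2 * y + 1"
    have x: "x = (z - 1) / 2" and y: "y = (w - 1) / 2"
      by (simp_all add: zw)
    \<comment> \<open>Subtracting the two equations removes \<open>b\<close>; the cubic terms cancel
      and the quadratic form remains, up to a constant.\<close>
    have "8 * f (x + 1) - 8 * f x = 8 * f (y + 1) - 8 * f y"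
      using xy by (simp add: algebra_simps flip: right_diff_distrib)
    then have "2 * (z\<^sup>2 + 2 * z * cj z) = 2 * (w\<^sup>2 + 2 * w * cj w)"
      unfolding x y f_half by (simp add: algebra_simps power2_eq_square)
    then have "w = z \<or> w = - z"
      using mult_left_cancel[OF numeral_nonzero(1)] by (intro quadratic_form_eq) blast
    moreover have "w \<noteq> z"
      using xy assms by (auto simp: zw)
    ultimately have u_eq: "u = ?h z"
      using u x y by simp
    moreover have "g z = 4 * b"
    proof -
      have "x = (z - 1) / 2" "y = (- z - 1) / 2"
        using u u_eq by simp_all
      then have "2 * g z = 8 * (f x - f y)"
        by (simp only: g_diff)
      also have "\<dots> = 2 * (4 * b)"
        using xy(1) by (simp only: iff)
      finally show ?thesis
        using mult_left_cancel[OF numeral_nonzero(1)] by blast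
    qed
    ultimately show "u \<in> ?h ` {t. g t = 4 * b}"
      by blast
  next
    fix u assume "u \<in> ?h ` {t. g t = 4 * b}"
    then obtain t where t: "g t = 4 * b" and u: "u = ?h t"
      by blast
    show "u \<in> ?A"
      unfolding u mem_Collect_eq case_prod_conv iff g_diff t by simp
  qed
  moreover have "inj_on ?h {t. g t = 4 * b}"
    by (rule inj_onI) simp
  ultimately show ?thesis
    unfolding boomerang_count_def by (simp add: card_image)
qed

section \<open>At most five points in a fibre\<close>

lemma card_square_plus_linear: "card {t :: 'a. t\<^sup>2 + u * t + v = 0} \<le> 2"
  by (rule card_le_degree[of "[:v, u, 1:]"]) (simp_all add: eval_nat_numeral algebra_simps)

lemma card_depressed_cubic: "e \<noteq> 0 \<Longrightarrow> card {t :: 'a. e * t ^ 3 + u * t + v = 0} \<le> 3"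
  by (rule card_le_degree[of "[:v, u, 0, e:]"]) (simp_all add: eval_nat_numeral algebra_simps)

lemma card_fibre_le:
  assumes "c \<noteq> 0"
  shows "card {t. g t = c} \<le> 5"
proof -
  let ?T = "{t. g t = c}"
  let ?n = "\<lambda>t. t * cj t"
  have eq: "(?n t + 2) * t + cj t = c" "(?n t + 2) * cj t + t = cj c" if "t \<in> ?T" for t
  proof -
    show "(?n t + 2) * t + cj t = c"
      using that by (simp add: g_def algebra_simps power2_eq_square)
    from arg_cong[OF this, of cj] show "(?n t + 2) * cj t + t = cj c"
      by (simp add: algebra_simps)
  qed
  \<comment> \<open>For a given norm, \<open>g t = c\<close> and its conjugate are linear in
    \<open>t\<close> and \<open>cj t\<close>, with determinant
    \<open>(?n t + 2)\<^sup>2 - 1 = (?n t + 1) * (?n t + 3)\<close>.\<close>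
  have solve: "(?n t + 1) * (?n t + 3) * t = (?n t + 2) * c - cj c"
      "(?n t + 1) * (?n t + 3) * cj t = (?n t + 2) * cj c - c" if "t \<in> ?T" for t
    unfolding eq(1)[OF that, symmetric] eq(2)[OF that, symmetric] by (simp_all add: algebra_simps)
  have bound: "card ?T \<le> 5" if "?T \<subseteq> A \<union> B" "card A \<le> 3" "card B \<le> 2" for A B
    using that card_mono[OF _ that(1)] card_Un_le[of A B] by simp
  consider t where "t \<in> ?T" "?n t = -3" | t where "t \<in> ?T" "?n t = -1"
    | "\<And>t. t \<in> ?T \<Longrightarrow> (?n t + 1) * (?n t + 3) \<noteq> 0"
    by (metis add_eq_0_iff2 mult_eq_0_iff)
  then show ?thesis
  proof cases
    case (1 t0)
    then have "cj t0 - t0 = c" "t0 - cj t0 = cj c"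
      using eq[of t0] by (simp_all only:) (simp_all add: algebra_simps)
    then have c': "cj c = - c"
      by (metis minus_diff_eq)
    \<comment> \<open>A point of norm -3 solves the quadratic; any other point satisfies
      \<open>cj t = - t\<close> and solves the cubic.\<close>
    have "t \<in> {t. 1 * t ^ 3 + (-1) * t + c = 0} \<union> {t. t\<^sup>2 + c * t + 3 = 0}" if t: "t \<in> ?T" for t
    proof (cases "?n t = -3")
      case True
      with eq(1)[OF t] have "cj t = t + c"
        by (simp add: algebra_simps)
      with True have "t * (t + c) + 3 = 0"
        by simp
      then show ?thesis
        by (simp add: algebra_simps power2_eq_square)
    next
      case False
      then have nz: "?n t + 3 \<noteq> 0"
        by (metis add_eq_0_iff2)
      from solve(1)[OF t] have "(?n t + 3) * ((?n t + 1) * t) = (?n t + 3) * c"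
        by (simp add: c' algebra_simps)
      with nz have e1: "(?n t + 1) * t = c"
        by simp
      from solve(2)[OF t] have "(?n t + 3) * ((?n t + 1) * cj t) = (?n t + 3) * (- c)"
        by (simp add: c' algebra_simps)
      with nz have "(?n t + 1) * cj t = - c"
        by (metis mult_left_cancel)
      with e1 have "(?n t + 1) * cj t = (?n t + 1) * (- t)"
        by simp
      moreover have "?n t + 1 \<noteq> 0"
        using e1 assms by auto
      ultimately have "cj t = - t"
        by (metis mult_left_cancel)
      with e1 show ?thesis
        by (auto simp: algebra_simps power3_eq_cube)
    qed
    then show ?thesis
      using card_depressed_cubic[of 1 "-1" c] card_square_plus_linear[of c 3] by (intro bound) auto
  next
    case (2 t0)
    then have "t0 + cj t0 = c" "cj t0 + t0 = cj c"
      using eq[of t0] by (simp_all only:) (simp_all add: algebra_simps)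
    then have c': "cj c = c"
      by (metis add.commute)
    \<comment> \<open>Points of norm -1 solve the quadratic; all others are fixed by
      \<open>cj\<close> and solve the cubic.\<close>
    have "t \<in> {t. 1 * t ^ 3 + 3 * t + (- c) = 0} \<union> {t. t\<^sup>2 + (- c) * t + (-1) = 0}" if t: "t \<in> ?T" for t
    proof (cases "?n t = -1")
      case True
      with eq(1)[OF t] have "cj t = c - t"
        by (simp add: algebra_simps)
      with True show ?thesis
        by (simp add: algebra_simps power2_eq_square)
    next
      case False
      then have nz: "?n t + 1 \<noteq> 0"
        by (metis add_eq_0_iff2)
      from solve(1)[OF t] have "(?n t + 1) * ((?n t + 3) * t) = (?n t + 1) * c"
        by (simp add: c' algebra_simps)
      with nz have e1: "(?n t + 3) * t = c"
        by simp
      from solve(2)[OF t] have "(?n t + 1) * ((?n t + 3) * cj t) = (?n t + 1) * c"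
        by (simp add: c' algebra_simps)
      with nz have "(?n t + 3) * cj t = c"
        by (metis mult_left_cancel)
      with e1 have "(?n t + 3) * cj t = (?n t + 3) * t"
        by simp
      moreover have "?n t + 3 \<noteq> 0"
        using e1 assms by auto
      ultimately have "cj t = t"
        by (metis mult_left_cancel)
      with e1 show ?thesis
        by (auto simp: algebra_simps power3_eq_cube)
    qed
    then show ?thesis
      using card_depressed_cubic[of 1 3 "- c"] card_square_plus_linear[of "- c" "-1"]
      by (intro bound) auto
  next
    case 3
    \<comment> \<open>With nonzero determinant the norm determines \<open>t\<close>. Multiplying the
      two equations of \<open>solve\<close> gives the quintic \<open>P\<close> for the norm.\<close>
    define e e' where e: "e = 2 * c - cj c" "e' = 2 * cj c - c"
    define P where "P = [:- e * e', 9 - (c * e' + cj c * e), 24 - c * cj c, 22, 8, 1:]"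
    have "inj_on ?n ?T"
    proof (rule inj_onI)
      fix t u assume tu: "t \<in> ?T" "u \<in> ?T" "?n t = ?n u"
      then have "(?n t + 1) * (?n t + 3) * t = (?n t + 1) * (?n t + 3) * u"
        using solve(1)[of t] solve(1)[of u] by simp
      with 3[OF tu(1)] show "t = u"
        using mult_left_cancel by blast
    qed
    then have "card ?T = card (?n ` ?T)"
      by (simp add: card_image)
    also have "\<dots> \<le> 5"
    proof (rule card_le_degree[of P])
      show "coeff P 5 \<noteq> 0" "degree P \<le> 5"
        by (simp_all add: P_def eval_nat_numeral)
      fix x assume "x \<in> ?n ` ?T"
      then obtain t where t: "t \<in> ?T" "x = ?n t"
        by blast
      have "x * ((x + 1) * (x + 3))\<^sup>2 = ((x + 1) * (x + 3) * t) * ((x + 1) * (x + 3) * cj t)"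
        by (simp add: t power2_eq_square mult_ac)
      also have "\<dots> = ((x + 2) * c - cj c) * ((x + 2) * cj c - c)"
        unfolding t(2) solve[OF t(1)] ..
      finally have "x * ((x + 1) * (x + 3))\<^sup>2 - ((x + 2) * c - cj c) * ((x + 2) * cj c - c) = 0"
        by simp
      moreover have "poly P x = x * ((x + 1) * (x + 3))\<^sup>2 - ((x + 2) * c - cj c) * ((x + 2) * cj c - c)"
        by (simp add: P_def e algebra_simps power2_eq_square)
      ultimately show "poly P x = 0"
        by simp
    qed
    finally show ?thesis .
  qed
qed

text \<open>
  Over \<open>c = s - s\<^sup>3\<close> lie the three roots \<open>s\<close>, \<open>(-s \<plusminus> b) / 2\<close> of \<open>t - t\<^sup>3 = c\<close>, with \<open>cj(t) = -t\<close>, and the two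
  points \<open>-c / 2 \<plusminus> r\<close> of norm \<open>-3\<close>.
\<close>

definition witness :: "'a \<Rightarrow> 'a \<Rightarrow> 'a \<Rightarrow> bool" where
  "witness s b r \<longleftrightarrow> cj s = - s \<and> s \<noteq> 0 \<and> 3 * s\<^sup>2 \<noteq> 1 \<and> cj b = - b \<and> b \<noteq> 0 \<and> b\<^sup>2 = 4 - 3 * s\<^sup>2
     \<and> cj r = r \<and> r \<noteq> 0 \<and> 4 * r\<^sup>2 = (s - s ^ 3)\<^sup>2 - 12"

lemma card_fibre_ge:
  assumes "witness s b r"
  defines "c \<equiv> s - s ^ 3"
  shows "c \<noteq> 0" "card {t. g t = c} \<ge> 5"
proof -
  have s: "cj s = - s" "s \<noteq> 0" "3 * s\<^sup>2 \<noteq> 1" and b: "cj b = - b" "b \<noteq> 0" "b\<^sup>2 = 4 - 3 * s\<^sup>2"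
    and r: "cj r = r" "r \<noteq> 0" "4 * r\<^sup>2 = c\<^sup>2 - 12"
    using assms by (auto simp: witness_def)
  have c': "cj c = - c"
    using s by (simp add: c_def)
  show "c \<noteq> 0"
  proof
    assume "c = 0"
    then have "s * ((1 - s) * (1 + s)) = 0"
      by (simp add: c_def algebra_simps power3_eq_cube)
    with s(2) have "s = 1 \<or> s = -1"
      by (auto simp: add_eq_0_iff)
    with s(1) show False
      by (auto simp: eq_neg_self_iff)
  qed
  have g_anti: "g t = t - t ^ 3" if "cj t = - t" for t
    unfolding g_def that by (simp add: power2_eq_square power3_eq_cube)
  define s1 s2 t1 t2 where st: "s1 = (b - s) / 2" "s2 = (- b - s) / 2" "t1 = r - c / 2" "t2 = - r - c / 2"
  have st2: "2 * s1 = b - s" "2 * s2 = - b - s" "2 * t1 = 2 * r - c" "2 * t2 = - 2 * r - c"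
    by (simp_all add: st)
  have cj_st: "cj s1 = - s1" "cj s2 = - s2" "cj t1 = t1 + c" "cj t2 = t2 + c"
    by (simp_all add: st s b r c' field_simps)
  \<comment> \<open>\<open>b\<^sup>2\<close> is the discriminant of
    \<open>t\<^sup>2 + s * t + s\<^sup>2 - 1\<close>, the cofactor of the root \<open>s\<close> in
    the cubic.\<close>
  have root: "t - t ^ 3 = c" if "(2 * t + s)\<^sup>2 = b\<^sup>2" for t
  proof -
    have "4 * (t\<^sup>2 + s * t + s\<^sup>2 - 1) = (2 * t + s)\<^sup>2 - (4 - 3 * s\<^sup>2)"
      by (simp add: algebra_simps power2_eq_square)
    also have "\<dots> = 0"
      using that b(3) by simp
    finally have "t\<^sup>2 + s * t + s\<^sup>2 - 1 = 0"
      unfolding mult_eq_0_iff by simp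
    moreover have "(t - t ^ 3) - c = (s - t) * (t\<^sup>2 + s * t + s\<^sup>2 - 1)"
      by (simp add: c_def algebra_simps power2_eq_square power3_eq_cube)
    ultimately show ?thesis
      by simp
  qed
  have "g s = c" "g s1 = c" "g s2 = c"
    using root[of s1] root[of s2] by (simp_all add: g_anti s cj_st c_def st2)
  moreover have "g t = c" if "cj t = t + c" "(2 * t + c)\<^sup>2 = (2 * r)\<^sup>2" for t
  proof -
    have "4 * (t * cj t + 3) = (2 * t + c)\<^sup>2 - (c\<^sup>2 - 12)"
      unfolding that(1) by (simp add: algebra_simps power2_eq_square)
    also have "\<dots> = 0"
      unfolding that(2) r(3)[symmetric] by (simp add: power_mult_distrib)
    finally have "t * cj t + 3 = 0"
      unfolding mult_eq_0_iff by simp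
    then have "t * cj t = -3"
      by (simp add: add_eq_0_iff2)
    moreover have "g t = t * (t * cj t) + 2 * t + cj t"
      by (simp add: g_def power2_eq_square mult_ac)
    ultimately show ?thesis
      by (simp add: that(1))
  qed
  from this[of t1] this[of t2] have "g t1 = c" "g t2 = c"
    by (simp_all add: cj_st st2)
  ultimately have "{s, s1, s2, t1, t2} \<subseteq> {t. g t = c}"
    by auto
  moreover have "card {s, s1, s2, t1, t2} = 5"
  proof -
    have "s1 \<noteq> s2" "t1 \<noteq> t2"
      using b(2) r(2) by (auto simp: st eq_neg_self_iff)
    \<comment> \<open>The condition \<open>3 * s\<^sup>2 \<noteq> 1\<close> says that
      \<open>s\<close> is not a double root of the cubic.\<close>
    moreover have "s \<noteq> t" if "(2 * t + s)\<^sup>2 = b\<^sup>2" for t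
    proof
      assume "s = t"
      with that have "9 * s\<^sup>2 - b\<^sup>2 = 0"
        by (simp add: algebra_simps power2_eq_square)
      then have "4 * (3 * s\<^sup>2 - 1) = 0"
        unfolding b(3) by (simp add: algebra_simps)
      with s(3) show False
        unfolding mult_eq_0_iff by simp
    qed
    from this[of s1] this[of s2] have "s \<noteq> s1" "s \<noteq> s2"
      by (simp_all add: st2)
    \<comment> \<open>Conjugation negates the roots of the cubic but not the two points of norm -3,
      so the two groups are disjoint.\<close>
    moreover have "cj t \<noteq> - t" if "cj t = t + c" "2 * t + c \<noteq> 0" for t
    proof
      assume anti: "cj t = - t"
      have "2 * t + c = t + cj t"
        unfolding that(1) mult_2 by (rule add.assoc)
      also have "\<dots> = 0"
        unfolding anti by (rule add.right_inverse)
      finally show False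
        using that(2) by contradiction
    qed
    from this[of t1] this[of t2] have "cj t1 \<noteq> - t1" "cj t2 \<noteq> - t2"
      using r(2) by (simp_all only: cj_st st2) simp_all
    then have "t1 \<noteq> s" "t1 \<noteq> s1" "t1 \<noteq> s2" "t2 \<noteq> s" "t2 \<noteq> s1" "t2 \<noteq> s2"
      using s(1) cj_st by auto
    ultimately show ?thesis
      by auto
  qed
  ultimately show "card {t. g t = c} \<ge> 5"
    by (metis card_mono finite_code)
qed

lemma boomerang_uniformity_eq_5:
  assumes "witness s b r"
  shows "boomerang_uniformity f = 5"
  unfolding boomerang_uniformity_def
proof (rule Max_eqI)
  have "{boomerang_count f a b |a b. a \<noteq> 0 \<and> b \<noteq> 0} \<subseteq> (\<lambda>(a, b). boomerang_count f a b) ` UNIV"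
    by auto
  then show "finite {boomerang_count f a b |a b. a \<noteq> 0 \<and> b \<noteq> 0}"
    by (rule finite_subset) simp
next
  fix y assume "y \<in> {boomerang_count f a b |a b. a \<noteq> 0 \<and> b \<noteq> 0}"
  then obtain a b where y: "y = boomerang_count f a b" "a \<noteq> 0" "b \<noteq> 0"
    by blast
  then have "b / f a \<noteq> 0"
    by simp
  then show "y \<le> 5"
    unfolding y(1) boomerang_count_scale[OF y(2)]
    by (subst boomerang_count_eq_card_fibre) (auto intro!: card_fibre_le)
next
  let ?c = "s - s ^ 3"
  have c: "?c \<noteq> 0" "card {t. g t = ?c} \<ge> 5"
    using card_fibre_ge[OF assms] by auto
  then have "boomerang_count f 1 (?c / 4) = 5"
    using card_fibre_le[OF c(1)] boomerang_count_eq_card_fibre[of "?c / 4"]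
    by (simp only: times_divide_eq_right nonzero_mult_div_cancel_left numeral_Bit0_eq_0 numeral_nonzero
        divide_eq_0_iff simp_thms) simp
  then show "5 \<in> {boomerang_count f a b |a b. a \<noteq> 0 \<and> b \<noteq> 0}"
    using c(1) by (intro CollectI exI[of _ 1] exI[of _ "?c / 4"]) auto
qed

section \<open>Fibres with five points\<close>

lemma fixed_power_eq_1:
  assumes "cj x = x" "x \<noteq> 0"
  shows "x ^ (q - 1) = 1"
proof -
  have "x ^ (q - 1) * x = cj x"
    unfolding cj_eq using q_ge_7 by (intro power_minus_mult) simp
  with assms show ?thesis
    by simp
qed

lemma ex_sqrt_cj:
  assumes "cj x = x" "x ^ ((q - 1) div 2) = e" "e \<noteq> 0"
  shows "\<exists>y. y\<^sup>2 = x \<and> cj y = e * y \<and> y \<noteq> 0"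
proof -
  have "(q - 1) div 2 > 0"
    using q_ge_7 by simp
  with assms(2,3) have "x \<noteq> 0"
    by (auto simp: power_0_left)
  with assms(1) obtain y where "y\<^sup>2 = x"
    using ex_sqrt_fixed by blast
  then show ?thesis
    using cj_sqrt[of y] assms(2) \<open>x \<noteq> 0\<close> by (intro exI[of _ y]) (auto simp: mult.commute)
qed

text \<open>\<open>z\<close> plays the role of \<open>s\<^sup>2\<close>; the powers say that
  \<open>s\<close> and \<open>b\<close> are negated by \<open>cj\<close> and that \<open>r\<close>
  is fixed.\<close>

lemma ex_witness_of_square:
  assumes z: "cj z = z" "3 * z \<noteq> 1"
    and pow: "z ^ ((q - 1) div 2) = -1" "(4 - 3 * z) ^ ((q - 1) div 2) = -1"
      "(z * (1 - z)\<^sup>2 - 12) ^ ((q - 1) div 2) = 1"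
  shows "\<exists>s b r. witness s b r"
proof -
  obtain s where s: "s\<^sup>2 = z" "cj s = - 1 * s" "s \<noteq> 0"
    using ex_sqrt_cj[OF z(1) pow(1)] by auto
  obtain b where b: "b\<^sup>2 = 4 - 3 * z" "cj b = - 1 * b" "b \<noteq> 0"
    using ex_sqrt_cj[OF _ pow(2)] z by auto
  obtain r where r: "r\<^sup>2 = z * (1 - z)\<^sup>2 - 12" "cj r = 1 * r" "r \<noteq> 0"
    using ex_sqrt_cj[OF _ pow(3)] z by auto
  have "s - s ^ 3 = s * (1 - s\<^sup>2)"
    by (simp add: algebra_simps power2_eq_square power3_eq_cube)
  then have "(s - s ^ 3)\<^sup>2 = z * (1 - z)\<^sup>2"
    by (simp add: power_mult_distrib s)
  then have "witness s b (r / 2)"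
    using s b r z(2) by (simp add: witness_def power_divide)
  then show ?thesis
    by blast
qed

text \<open>Cardano's substitution \<open>s = (v - 1 / v) / t\<close> with
  \<open>t\<^sup>2 = -3\<close> makes \<open>4 - 3 * s\<^sup>2\<close> the square of
  \<open>v + 1 / v\<close>. Only the condition on \<open>c\<^sup>2 - 12\<close> then remains, where
  \<open>3 * t * c = v ^ 3 - 1 / v ^ 3\<close>.\<close>

lemma ex_witness_of_parameter:
  assumes v: "cj v = - v" "v ^ 6 \<noteq> -1" "(v ^ 12 + 322 * v ^ 6 + 1) ^ ((q - 1) div 2) = -1"
  shows "\<exists>s b r. witness s b r"
proof -
  let ?N = "(q - 1) div 2"
  have "v \<noteq> 0"
    using v(3) by (auto simp: eq_neg_self_iff)
  obtain t where t: "t\<^sup>2 = -3" "cj t = t"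
    using ex_sqrt_minus_3 by blast
  have "t\<^sup>2 \<noteq> 0"
    unfolding t by simp
  then have "t \<noteq> 0"
    by simp
  define y where "y = 1 / v"
  have vy: "v * y = 1" "cj y = - y"
    using \<open>v \<noteq> 0\<close> v(1) by (simp_all add: y_def)
  define s b where sb: "s = (v - y) / t" "b = v + y"
  have ts: "t * s = v - y"
    using \<open>t \<noteq> 0\<close> by (simp add: sb)
  have "-3 * s\<^sup>2 = (v - y)\<^sup>2"
    unfolding ts[symmetric] power_mult_distrib t ..
  then have s2: "3 * s\<^sup>2 = - ((v - y)\<^sup>2)"
    by (metis minus_mult_left minus_minus)
  \<comment> \<open>The first factor vanishes if \<open>b = 0\<close> and the second if
    \<open>3 * s\<^sup>2 = 1\<close>, so \<open>v ^ 6 \<noteq> -1\<close> excludes both.\<close>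
  have six: "v ^ 6 + 1 = (v\<^sup>2 + 1) * (v ^ 4 - v\<^sup>2 + 1)"
    by (simp add: algebra_simps flip: power_add)
  have v6: "v ^ 6 + 1 \<noteq> 0"
    using v(2) by (simp add: eq_neg_iff_add_eq_0)
  have b_nz: "b \<noteq> 0"
  proof
    assume "b = 0"
    have "v\<^sup>2 + 1 = v * b"
      by (simp add: sb distrib_left vy power2_eq_square)
    with \<open>b = 0\<close> v6 show False
      by (simp add: six)
  qed
  have s_nz: "s \<noteq> 0"
  proof
    assume "s = 0"
    with ts have "v = y"
      by simp
    with vy have "(v - 1) * (v + 1) = 0"
      by (simp add: algebra_simps)
    then have "v = 1 \<or> v = -1"
      by (simp add: eq_neg_iff_add_eq_0)
    with v(1) show False
      by (auto simp: eq_neg_self_iff)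
  qed
  have s2_ne: "3 * s\<^sup>2 \<noteq> 1"
  proof
    assume "3 * s\<^sup>2 = 1"
    then have "(v - y)\<^sup>2 + 1 = (v - y)\<^sup>2 + 3 * s\<^sup>2"
      by simp
    then have "(v - y)\<^sup>2 + 1 = 0"
      unfolding s2 by simp
    moreover have "v\<^sup>2 * ((v - y)\<^sup>2 + 1) = v ^ 4 - v\<^sup>2 + 1"
      using vy(1) by algebra
    ultimately have "v ^ 4 - v\<^sup>2 + 1 = 0"
      by simp
    with v6 show False
      by (simp add: six)
  qed
  have "b\<^sup>2 = 4 - 3 * s\<^sup>2"
    unfolding s2 unfolding sb(2) using vy(1) by algebra
  define c k where ck: "c = s - s ^ 3" "k = c\<^sup>2 - 12"
  have "t ^ 3 = - 3 * t"
    using t(1) by (simp add: power3_eq_cube power2_eq_square)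
  have "3 * t * c = 3 * (t * s) + (t * s) ^ 3"
    unfolding ck power_mult_distrib \<open>t ^ 3 = - 3 * t\<close> by (simp add: algebra_simps)
  also have "\<dots> = v ^ 3 - y ^ 3"
    unfolding ts using vy(1) by algebra
  finally have tc: "3 * t * c = v ^ 3 - y ^ 3" .
  have "(3 * t)\<^sup>2 * v ^ 6 * k = v ^ 6 * (3 * t * c)\<^sup>2 - 12 * (3 * t)\<^sup>2 * v ^ 6"
    unfolding ck(2) by (simp add: algebra_simps power_mult_distrib)
  \<comment> \<open>Here \<open>(3 * t)\<^sup>2 = -27\<close>, which gives 324; the cross term of
    the square lowers it to 322.\<close>
  also have "\<dots> = v ^ 6 * (v ^ 3 - y ^ 3)\<^sup>2 + 324 * v ^ 6"
    unfolding tc by (simp add: power_mult_distrib t)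
  also have "\<dots> = v ^ 12 + 322 * v ^ 6 + 1"
    using vy(1) by algebra
  finally have k_eq: "(3 * t)\<^sup>2 * v ^ 6 * k = v ^ 12 + 322 * v ^ 6 + 1" .
  have "(3 * t) ^ (q - 1) = 1"
    using t \<open>t \<noteq> 0\<close> by (intro fixed_power_eq_1) simp_all
  then have "((3 * t)\<^sup>2) ^ ?N = 1"
    by (simp only: even_q_minus_1 flip: power_mult)
  \<comment> \<open>Since \<open>cj\<close> negates \<open>v\<close>, both \<open>v\<^sup>2\<close>
    and \<open>v ^ 6\<close> are nonsquares in the fixed field, so a nonsquare right side of
    \<open>k_eq\<close> makes \<open>k\<close> a square there.\<close>
  moreover have "v * (v\<^sup>2) ^ ?N = v * (-1)"
    using cj_sqrt[of v] v(1) by simp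
  then have "(v\<^sup>2) ^ ?N = -1"
    unfolding mult_cancel_left using \<open>v \<noteq> 0\<close> by simp
  moreover have "(v ^ 6) ^ ?N = ((v\<^sup>2) ^ ?N) ^ 3"
    by (simp add: mult.commute flip: power_mult)
  ultimately have "k ^ ?N = 1"
    using arg_cong[OF k_eq, of "\<lambda>x. x ^ ?N"] v(3) by (simp add: power_mult_distrib)
  moreover have cj_s: "cj s = - s"
    using v(1) t(2) vy(2) by (simp add: sb minus_divide_left)
  then have "cj k = k"
    by (simp add: ck power2_commute)
  ultimately obtain r where "r\<^sup>2 = k" "cj r = 1 * r" "r \<noteq> 0"
    using ex_sqrt_cj[of k 1] by auto
  then have "witness s b (r / 2)"
    using s_nz b_nz s2_ne \<open>b\<^sup>2 = 4 - 3 * s\<^sup>2\<close> v(1) vy(2) cj_s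
    by (simp add: witness_def power_divide ck(2) sb(2) flip: ck(1))
  then show ?thesis
    by blast
qed

section \<open>Large \<open>q\<close>: the Stepanov bound\<close>

lemma stepanov_poly_not_square:
  fixes a b :: "'a poly"
  assumes "a\<^sup>2 * (monom 1 12 + monom 322 6 + 1) = b\<^sup>2"
  shows "a = 0"
proof -
  let ?W = "monom 1 6 + [:161:] :: 'a poly"
  \<comment> \<open>Completing the square gives the constant \<open>161\<^sup>2 - 1 = 25920\<close>,
    whose prime factors are below \<open>p\<close>.\<close>
  have "25920 = (2 ^ 6 * 3 ^ 4 * 5 :: 'a)"
    by simp
  also have "\<dots> \<noteq> 0"
    unfolding mult_eq_0_iff power_eq_0_iff by simp
  finally have "(25920::'a) \<noteq> 0" .
  moreover have "?W\<^sup>2 - [:25920:] = monom 1 12 + monom 322 6 + 1"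
  proof -
    have "[:25920:] = [:161:]\<^sup>2 - (1 :: 'a poly)"
      by (simp add: poly_const_pow one_pCons)
    moreover have "(x + y)\<^sup>2 - (y\<^sup>2 - 1) = x\<^sup>2 + 2 * (x * y) + 1" for x y :: "'a poly"
      by (simp add: power2_eq_square algebra_simps)
    ultimately have "?W\<^sup>2 - [:25920:] = (monom 1 6)\<^sup>2 + 2 * (monom 1 6 * [:161:]) + 1"
      by simp
    also have "monom 1 6 * [:161:] = (monom 161 6 :: 'a poly)"
      by (simp add: smult_monom)
    finally show ?thesis
      by (simp add: monom_power numeral_mult_conv_smult smult_monom)
  qed
  moreover have "degree ?W = 6"
    by (simp add: degree_add_eq_left degree_monom_eq)
  ultimately show ?thesis
    using square_minus_const_not_square[of ?W 25920 a b] assms by simp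
qed

lemma ex_witness_if_large:
  assumes "q \<ge> 639"
  shows "\<exists>s b r. witness s b r"
proof (rule ccontr)
  assume none: "\<nexists>s b r. witness s b r"
  let ?F = "monom 1 12 + monom 322 6 + 1 :: 'a poly"
  define N D where ND: "N = (q - 1) div 2" "D = (q - 13) div 2"
  have N: "q = Suc (2 * N)" and D: "2 * D + 13 = q"
    using q_mod_6 assms unfolding ND by presburger+
  have F: "poly ?F v = v ^ 12 + 322 * v ^ 6 + 1" for v
    by (simp add: poly_monom)
  \<comment> \<open>The removed sets have at most 6 and 12 elements, so \<open>S\<close> keeps at
    least \<open>q - 18\<close>.\<close>
  define S where "S = {v. cj v = - v} - {v. v ^ 6 = -1} - {v. poly ?F v = 0}"
  have "degree (monom 322 6 + 1 :: 'a poly) \<le> 6"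
    by (intro degree_add_le degree_monom_le) simp
  then have degF: "degree ?F = Suc 11"
    unfolding add.assoc by (subst degree_add_eq_left) (simp_all add: degree_monom_eq)
  have "card {v \<in> UNIV. v ^ 6 = (-1 :: 'a)} \<le> 6"
    by (intro card_nth_roots_le) simp
  moreover have "card {v. poly ?F v = 0} \<le> 12"
    using card_poly_roots_bound[of ?F] degF by force
  ultimately have "q - 18 \<le> card S"
    using card_cj_eq_minus diff_card_le_card_Diff[of "{v. v ^ 6 = (-1 :: 'a)}" "{v. cj v = - v}"]
      diff_card_le_card_Diff[of "{v. poly ?F v = 0}" "{v. cj v = - v} - {v. v ^ 6 = -1}"]
    unfolding S_def by simp
  \<comment> \<open>Here \<open>J = 12\<close> and \<open>M = 18\<close>. The count requires
    \<open>1899 + 18 * D < 24 * D + 24\<close>, that is \<open>D \<ge> 313\<close>, which is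
    \<open>q \<ge> 639\<close>. The resulting bound
    \<open>18 * (q - 18) \<le> 11 * q + D + 12 * N\<close> would force
    \<open>q \<le> 623\<close>.\<close>
  moreover have "card S * 18 \<le> q * (12 - 1) + D + Suc 11 * N"
  proof (rule stepanov[where F = ?F and e = "-1" and m = m])
    show "q = CHAR('a) ^ m"
      by (simp add: CHAR_a q_eq)
    show "(\<Sum>l<18. 12 + D + 11 * l) < 2 * 12 * Suc D"
      using D assms by (simp add: sum.distrib lessThan_atLeast0 Sum_Ico_nat flip: sum_distrib_left)
    fix v assume v: "v \<in> S"
    then have cjv: "cj v = - v" and v6: "v ^ 6 \<noteq> -1" and nz: "poly ?F v \<noteq> 0"
      by (auto simp: S_def)
    have "cj (poly ?F v) = poly ?F v"
      unfolding F by (simp add: cjv)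
    from fixed_power_eq_1[OF this nz] have "(poly ?F v ^ N)\<^sup>2 = 1"
      using N by (simp add: mult.commute flip: power_mult)
    then have "poly ?F v ^ N = 1 \<or> poly ?F v ^ N = -1"
      by (simp add: power2_eq_1_iff)
    moreover have "poly ?F v ^ N \<noteq> -1"
      using ex_witness_of_parameter[OF cjv v6] none unfolding F ND by blast
    ultimately show "v ^ q = -1 * v \<and> poly ?F v ^ N = 1"
      using cjv by (simp add: cj_eq)
  qed (use N D assms degF in \<open>auto simp: poly_monom intro: stepanov_poly_not_square\<close>)
  ultimately show False
    using N D assms by simp
qed

section \<open>Small \<open>q\<close>: explicit certificates\<close>

lemma ex_witness_of_certificate:
  assumes cert: "certificate p' r zs" and q: "int q = p' ^ length zs"
  shows "\<exists>s b r. witness s b r"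
proof -
  define n N where "n = length zs" and "N = (q - 1) div 2"
  have n: "n > 0"
    using cert by (auto simp: certificate_def Let_def n_def)
  have N: "(int q - 1) div 2 = int N" "2 * N = q - 1" "N > 0"
    using q_mod_6 q_ge_7 unfolding N_def by presburger+
  have p': "of_int p' = (0::'a)"
  proof -
    have "(of_nat q :: 'a) = 0"
      unfolding of_nat_eq_0 using q_eq q_ge_7 by (cases m) auto
    then have "(of_int (int q) :: 'a) = 0"
      by simp
    then have "(of_int p' :: 'a) ^ n = 0"
      by (simp only: q n_def of_int_power)
    then show ?thesis
      by simp
  qed
  define k where "k = (q - 1) div n"
  have mod: "(int q - 1) mod int n = 0" and r: "power_list p' 0 [r] ((int q - 1) div int n) = [1]"
    using cert unfolding certificate_def Let_def n_def q by auto
  have int_q: "int q - 1 = int (q - 1)"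
    using q_ge_7 by simp
  have k: "(int q - 1) div int n = int k"
    unfolding int_q k_def by (simp flip: zdiv_int)
  have "n dvd q - 1"
    using mod unfolding int_q by presburger
  then have nk: "n * k = q - 1"
    by (simp add: k_def)
  \<comment> \<open>Arithmetic in the prime field: lists of length 1, evaluated at 0.\<close>
  interpret r: list_arith p' 0 "0::'a" 1
    by standard (simp_all add: p')
  have rk: "(of_int r :: 'a) ^ k = 1"
    using r.val_power[of "[r]" "int k"] r[unfolded k] by simp
  have "\<exists>x::'a. x ^ n = of_int r"
  proof (rule ex_nth_root)
    show "n * (k * (q + 1)) = card (UNIV :: 'a set) - 1"
    proof -
      have "n * (k * (q + 1)) = (q - 1) * (q + 1)"
        by (simp only: nk flip: mult.assoc)
      also have "\<dots> = q\<^sup>2 - 1"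
        by (simp add: power2_eq_square algebra_simps)
      finally show ?thesis
        by (simp only: CARD_eq)
    qed
    have "k > 0"
      using nk q_ge_7 by (cases k) auto
    with n show "0 < n * (k * (q + 1))"
      by simp
    show "(of_int r :: 'a) ^ (k * (q + 1)) = 1"
      by (simp only: power_mult rk power_one)
  qed
  then obtain x :: 'a where x: "x ^ n = of_int r"
    by blast
  \<comment> \<open>\<open>x ^ q = x * (x ^ n) ^ k = x * r ^ k = x\<close>, so the values of all
    lists lie in the fixed field.\<close>
  have cj_x: "cj x = x"
  proof -
    have "q = Suc (n * k)"
      using nk q_ge_7 by simp
    then have "cj x = x * (x ^ n) ^ k"
      unfolding cj_eq by (simp only: power_Suc power_mult)
    then show ?thesis
      by (simp add: x rk)
  qed
  interpret list_arith p' r x n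
    by standard (simp_all add: p' x n)
  define z where "z = val zs"
  have zs: "length zs = n" "zs \<noteq> []"
    using n by (auto simp: n_def)
  have "cj (val ys) = val ys" for ys
    by (induction ys) (simp_all add: cj_x)
  then have "cj z = z"
    by (simp add: z_def)
  let ?w = "affine_list p' (-1) 1 zs"
  let ?c = "\<lambda>c. c # map (\<lambda>_. 0) (tl zs)"
  have pows: "power_list p' r zs (int N) = ?c (p' - 1)"
    "power_list p' r (affine_list p' (-3) 4 zs) (int N) = ?c (p' - 1)"
    "power_list p' r (affine_list p' 1 (-12) (mult_list p' r zs (mult_list p' r ?w ?w))) (int N) = ?c 1"
    "power_list p' r (affine_list p' 3 (-1) zs) (2 * int N) = ?c 1"
    using cert unfolding certificate_def Let_def q[symmetric] N(1) by blast+
  have w: "val ?w = 1 - z" "length ?w = n"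
    using zs by (simp_all add: val_affine z_def)
  then have "?w \<noteq> []"
    using n by auto
  have "z ^ N = -1"
    using arg_cong[OF pows(1), of val] zs by (simp add: val_power val_zeros p' z_def)
  moreover have "(4 - 3 * z) ^ N = -1"
    using arg_cong[OF pows(2), of val] zs by (simp add: val_power val_affine val_zeros p' z_def)
  moreover have "(z * (1 - z)\<^sup>2 - 12) ^ N = 1"
    using arg_cong[OF pows(3), of val] zs w \<open>?w \<noteq> []\<close>
    by (simp add: val_power val_affine val_mult val_zeros power2_eq_square flip: z_def)
  moreover have "(3 * z - 1) ^ (2 * N) = 1"
    using arg_cong[OF pows(4), of val] zs
    by (simp add: val_power val_affine val_zeros nat_mult_distrib flip: z_def)
  then have "3 * z \<noteq> 1"
    using N(3) by (auto simp: power_0_left)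
  ultimately show ?thesis
    using \<open>cj z = z\<close> by (intro ex_witness_of_square) (simp_all add: N_def)
qed

lemma not_coprime_factors: "q = d * e \<Longrightarrow> d > 1 \<Longrightarrow> e > 1 \<Longrightarrow> \<not> coprime d e"
proof
  assume de: "q = d * e" "d > 1" "e > 1" "coprime d e"
  have "p dvd x" if "x dvd q" "x > 1" for x
  proof -
    obtain y where "prime y" "y dvd x"
      using prime_factor_nat[of x] \<open>x > 1\<close> by auto
    moreover from this have "y dvd p"
      using prime_dvd_power[of y p m] \<open>x dvd q\<close> q_eq dvd_trans by blast
    ultimately show ?thesis
      using prime_p primes_dvd_imp_eq by blast
  qed
  then have "p dvd d" "p dvd e"
    using de by simp_all
  with de(4) have "p dvd 1"
    by (simp add: coprime_def)
  with p_gt_5 show False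
    by simp
qed

lemma ex_witness_if_small:
  assumes "q < 639" "q \<notin> {7, 19, 313}"
  shows "\<exists>s b r. witness s b r"
proof -
  define k where "k = int (q div 6)"
  have k: "int q = 6 * k + 1" "k \<in> set [0..106]"
    using q_mod_6 assms(1) unfolding k_def by auto presburger+
  from certificates_complete k(2)
  consider "int q \<in> {1, 7, 19, 25, 313, 625}"
    | "list_ex (\<lambda>(p, r, zs). int q = p ^ length zs) certificates"
    | "list_ex (\<lambda>d. d < int q \<and> int q mod d = 0 \<and> gcd d (int q div d) = 1) [5, 7, 11, 13, 17, 19, 23, 25]"
    unfolding list_all_iff Let_def k(1) by blast
  then show ?thesis
  proof cases
    case 1
    \<comment> \<open>Since \<open>p > 5\<close>, the cases 25 and 625 left open by the table cannot
      occur.\<close>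
    have "q \<noteq> 5 ^ j" if "j > 0" for j
    proof
      assume "q = 5 ^ j"
      moreover have "p dvd q"
        using q_eq q_ge_7 by (cases m) auto
      ultimately have "p dvd 5"
        using prime_p prime_dvd_power by blast
      with p_gt_5 show False
        by (auto dest: dvd_imp_le)
    qed
    from this[of 2] this[of 4] have "q \<noteq> 25" "q \<noteq> 625"
      by simp_all
    with 1 assms(2) q_ge_7 show ?thesis
      by auto
  next
    case 2
    then obtain p' r zs where cert: "(p', r, zs) \<in> set certificates" "int q = p' ^ length zs"
      unfolding list_ex_iff by blast
    have "certificate p' r zs"
      using certificates_valid cert(1) unfolding list_all_iff by blast
    then show ?thesis
      using cert(2) by (rule ex_witness_of_certificate)
  next
    case 3
    then obtain d where d: "d \<in> set [5, 7, 11, 13, 17, 19, 23, 25]"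
        "d < int q \<and> int q mod d = 0 \<and> gcd d (int q div d) = 1"
      unfolding list_ex_iff by (rule bexE)
    have "d > 1"
      using d(1) by auto
    then obtain d' where d': "d = int d'"
      by (metis zero_less_imp_eq_int less_trans zero_less_one)
    have "d' dvd q" "coprime d' (q div d')" "d' > 1" "d' < q"
      using d \<open>d > 1\<close> unfolding d' by (auto simp: coprime_iff_gcd_eq_1 simp flip: zdiv_int zmod_int)
    then have "q = d' * (q div d')" "q div d' > 1"
      by (auto elim!: dvdE)
    with not_coprime_factors \<open>coprime d' (q div d')\<close> \<open>d' > 1\<close> show ?thesis
      by blast
  qed
qed

end

theorem theorem7:
  fixes p m q :: nat
  assumes "prime p" and "p > 5" and "m \<ge> 1" and "q = p ^ m"
    and "q mod 6 = 1" and "q \<notin> {7, 19, 313}"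
    and "card (UNIV :: 'a::{field,finite} set) = q ^ 2"
  shows "boomerang_uniformity (\<lambda>x::'a. x ^ (q + 2)) = 5"
proof -
  interpret quad_ext p m q "\<lambda>x::'a. x ^ q"
    by standard (use assms in auto)
  obtain s b r where "witness s b r"
    using ex_witness_if_small ex_witness_if_large assms(6) by (meson linorder_not_less)
  then show ?thesis
    using boomerang_uniformity_eq_5 unfolding f_eq_power by blast
qed

end
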